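(* Let $\kappa,c\in\mathbb{C}$ with $\kappa\neq0$. Then $W(\eta;\kappa,c)$ is a maximal submodule of $M(\eta)$ if and only if $(\kappa,c)$ is non-critical; and $V(\eta;\kappa,c)$ is an irreducible Whittaker module of type $\eta$ if and only if $(\kappa,c)$ is non-critical.
   Context: Fix $q\in\mathbb{C}\setminus\{0\}$ not a root of unity. $U=U_q(\mathfrak{sl}_3)$ is the associative $\mathbb{C}$-algebra generated by $E_1,E_2,F_1,F_2,K_1^{\pm1},K_2^{\pm1}$ subject to $K_iK_i^{-1}=K_i^{-1}K_i=1$, $K_1K_2=K_2K_1$, $[E_i,F_j]=\delta_{ij}\frac{K_i-K_i^{-1}}{q-q^{-1}}$, $K_iE_jK_i^{-1}=q^{a_{ij}}E_j$, $K_iF_jK_i^{-1}=q^{-a_{ij}}F_j$ for $i,j\in\{1,2\}$ with $a_{11}=a_{22}=2$, $a_{12}=a_{21}=-1$, and the quantum Serre relations $E_i^2E_j-(q+q^{-1})E_iE_jE_i+E_jE_i^2=0$, $F_i^2F_j-(q+q^{-1})F_iF_jF_i+F_jF_i^2=0$ for $i\neq j$. Let $U^+$ be the subalgebra generated by $E_1,E_2$. Fix $\alpha\in\mathbb{C}\setminus\{0\}$ and let $\eta:U^+\to\mathbb{C}$ be the algebra homomorphism with $\eta(E_1)=\alpha$, $\eta(E_2)=0$. $M(\eta)=U\otimes_{U^+}\mathbb{C}v_\eta$, where $xv_\eta=\eta(x)v_\eta$ for $x\in U^+$. A Whittaker module of type $\eta$ is a $U$-module generated by a nonzero vector $w$ with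 $E_1w=\alpha w$, $E_2w=0$. Put $K=K_1K_2^2$ and $C_1=F_1E_1+\frac{qK_1+q^{-1}K_1^{-1}}{(q-q^{-1})^2}$; $\mathbb{C}[K^{\pm1},C_1]$ is the commutative subalgebra they generate. For $\kappa\ne0$, $J(\kappa,c)$ is the ideal of $\mathbb{C}[K^{\pm1},C_1]$ generated by $K-\kappa$ and $C_1-c$; $W(\eta;\kappa,c)=U\,J(\kappa,c)v_\eta\subseteq M(\eta)$ and $V(\eta;\kappa,c)=M(\eta)/W(\eta;\kappa,c)$. For $n\in\mathbb{N}=\{1,2,\dots\}$ let $h_n(K,C_1)=q^{3-2n}K+q^{2n-3}K^{-1}-(q-q^{-1})^2C_1$. A pair $(\kappa,c)$ with $\kappa\neq0$ is critical if $h_n(\kappa,c)=0$ for some $n\in\mathbb{N}$, and non-critical otherwise. *)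

theory Defs
  imports Complex_Main "HOL-Library.Poly_Mapping"
begin

datatype gen = GE1 | GE2 | GF1 | GF2 | GK1 | GK1i | GK2 | GK2i

datatype word = Wd "gen list"

instantiation word :: monoid_add
begin
definition zero_word :: word where "zero_word = Wd []"
fun plus_word :: "word \<Rightarrow> word \<Rightarrow> word" where
  "plus_word (Wd a) (Wd b) = Wd (a @ b)"
instance
proof
  fix a b c :: word
  show "a + b + c = a + (b + c)" by (cases a; cases b; cases c) simp
  show "0 + a = a" by (cases a) (simp add: zero_word_def)
  show "a + 0 = a" by (cases a) (simp add: zero_word_def)
qed
end

text \<open>The free associative C-algebra on the generators (a ring_1 by convolution).\<close>
type_synonym fra = "word \<Rightarrow>\<^sub>0 complex"

definition gn :: "gen \<Rightarrow> fra" where "gn g = Poly_Mapping.single (Wd [g]) 1"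
definition sc :: "complex \<Rightarrow> fra" where "sc c = Poly_Mapping.single 0 c"

abbreviation "E1 \<equiv> gn GE1"
abbreviation "E2 \<equiv> gn GE2"
abbreviation "F1 \<equiv> gn GF1"
abbreviation "F2 \<equiv> gn GF2"
abbreviation "Kg1 \<equiv> gn GK1"
abbreviation "Kg1i \<equiv> gn GK1i"
abbreviation "Kg2 \<equiv> gn GK2"
abbreviation "Kg2i \<equiv> gn GK2i"

definition Eg :: "nat \<Rightarrow> fra" where "Eg i = (if i = 1 then E1 else E2)"
definition Fg :: "nat \<Rightarrow> fra" where "Fg i = (if i = 1 then F1 else F2)"
definition Kg :: "nat \<Rightarrow> fra" where "Kg i = (if i = 1 then Kg1 else Kg2)"
definition Kgi :: "nat \<Rightarrow> fra" where "Kgi i = (if i = 1 then Kg1i else Kg2i)"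

definition cartan :: "nat \<Rightarrow> nat \<Rightarrow> int" where "cartan i j = (if i = j then 2 else -1)"

text \<open>Defining relators of U_q(sl_3) (each relation written as lhs - rhs), indices i,j in {1,2}.\<close>
definition Urels :: "complex \<Rightarrow> fra set" where
  "Urels q =
     {Kg i * Kgi i - 1 | i. i \<in> {1,2}}
   \<union> {Kgi i * Kg i - 1 | i. i \<in> {1,2}}
   \<union> {Kg1 * Kg2 - Kg2 * Kg1}
   \<union> {Eg i * Fg j - Fg j * Eg i
        - (if i = j then sc (1 / (q - inverse q)) * (Kg i - Kgi i) else 0) | i j. i \<in> {1,2} \<and> j \<in> {1,2}}
   \<union> {Kg i * Eg j * Kgi i - sc (q powi cartan i j) * Eg j | i j. i \<in> {1,2} \<and> j \<in> {1,2}}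
   \<union> {Kg i * Fg j * Kgi i - sc (q powi (- cartan i j)) * Fg j | i j. i \<in> {1,2} \<and> j \<in> {1,2}}
   \<union> {Eg i * Eg i * Eg j - sc (q + inverse q) * Eg i * Eg j * Eg i + Eg j * Eg i * Eg i
        | i j. i \<in> {1,2} \<and> j \<in> {1,2} \<and> i \<noteq> j}
   \<union> {Fg i * Fg i * Fg j - sc (q + inverse q) * Fg i * Fg j * Fg i + Fg j * Fg i * Fg i
        | i j. i \<in> {1,2} \<and> j \<in> {1,2} \<and> i \<noteq> j}"

text \<open>Two-sided ideal of the free algebra generated by a set; U = fra / Uideal q.\<close>
inductive_set twosided_ideal :: "fra set \<Rightarrow> fra set" for S where
  base: "r \<in> S \<Longrightarrow> r \<in> twosided_ideal S"
| zero: "0 \<in> twosided_ideal S"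
| add: "a \<in> twosided_ideal S \<Longrightarrow> b \<in> twosided_ideal S \<Longrightarrow> a + b \<in> twosided_ideal S"
| mult: "a \<in> twosided_ideal S \<Longrightarrow> x * a * y \<in> twosided_ideal S"

definition Uideal :: "complex \<Rightarrow> fra set" where "Uideal q = twosided_ideal (Urels q)"

inductive_set subalg :: "fra set \<Rightarrow> fra set" for S where
  base: "r \<in> S \<Longrightarrow> r \<in> subalg S"
| scal: "sc c \<in> subalg S"
| add: "a \<in> subalg S \<Longrightarrow> b \<in> subalg S \<Longrightarrow> a + b \<in> subalg S"
| mult: "a \<in> subalg S \<Longrightarrow> b \<in> subalg S \<Longrightarrow> a * b \<in> subalg S"

record 'v amod =
  car :: "'v set"
  addm :: "'v \<Rightarrow> 'v \<Rightarrow> 'v"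
  zerom :: 'v
  actm :: "fra \<Rightarrow> 'v \<Rightarrow> 'v"

definition is_amodule :: "'v amod \<Rightarrow> bool" where
  "is_amodule M \<longleftrightarrow>
     zerom M \<in> car M
   \<and> (\<forall>x\<in>car M. \<forall>y\<in>car M. addm M x y \<in> car M)
   \<and> (\<forall>r. \<forall>x\<in>car M. actm M r x \<in> car M)
   \<and> (\<forall>x\<in>car M. \<forall>y\<in>car M. \<forall>z\<in>car M. addm M (addm M x y) z = addm M x (addm M y z))
   \<and> (\<forall>x\<in>car M. \<forall>y\<in>car M. addm M x y = addm M y x)
   \<and> (\<forall>x\<in>car M. addm M (zerom M) x = x)
   \<and> (\<forall>x\<in>car M. \<exists>y\<in>car M. addm M x y = zerom M)
   \<and> (\<forall>r. \<forall>x\<in>car M. \<forall>y\<in>car M. actm M r (addm M x y) = addm M (actm M r x) (actm M r y))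
   \<and> (\<forall>r s. \<forall>x\<in>car M. actm M (r + s) x = addm M (actm M r x) (actm M s x))
   \<and> (\<forall>r s. \<forall>x\<in>car M. actm M (r * s) x = actm M r (actm M s x))
   \<and> (\<forall>x\<in>car M. actm M 1 x = x)"

definition is_Umodule :: "complex \<Rightarrow> 'v amod \<Rightarrow> bool" where
  "is_Umodule q M \<longleftrightarrow> is_amodule M \<and> (\<forall>r\<in>Urels q. \<forall>x\<in>car M. actm M r x = zerom M)"

definition submod :: "'v amod \<Rightarrow> 'v set \<Rightarrow> bool" where
  "submod M N \<longleftrightarrow> N \<subseteq> car M \<and> zerom M \<in> N
     \<and> (\<forall>x\<in>N. \<forall>y\<in>N. addm M x y \<in> N) \<and> (\<forall>r. \<forall>x\<in>N. actm M r x \<in> N)"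

definition gen_submod :: "'v amod \<Rightarrow> 'v set \<Rightarrow> 'v set" where
  "gen_submod M S = \<Inter> {N. submod M N \<and> S \<subseteq> N}"

definition maximal_submod :: "'v amod \<Rightarrow> 'v set \<Rightarrow> bool" where
  "maximal_submod M N \<longleftrightarrow> submod M N \<and> N \<noteq> car M
     \<and> (\<forall>N'. submod M N' \<and> N \<subseteq> N' \<longrightarrow> N' = N \<or> N' = car M)"

definition simple_mod :: "'v amod \<Rightarrow> bool" where
  "simple_mod M \<longleftrightarrow> car M \<noteq> {zerom M}
     \<and> (\<forall>N. submod M N \<longrightarrow> N = {zerom M} \<or> N = car M)"

text \<open>Whittaker module of type eta (eta(E1) = alpha, eta(E2) = 0).\<close>
definition whittaker_mod :: "complex \<Rightarrow> complex \<Rightarrow> 'v amod \<Rightarrow> bool" where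
  "whittaker_mod q \<alpha> M \<longleftrightarrow> is_Umodule q M \<and>
     (\<exists>w\<in>car M. w \<noteq> zerom M \<and> actm M E1 w = actm M (sc \<alpha>) w \<and> actm M E2 w = zerom M
        \<and> gen_submod M {w} = car M)"

definition irr_whittaker_mod :: "complex \<Rightarrow> complex \<Rightarrow> 'v amod \<Rightarrow> bool" where
  "irr_whittaker_mod q \<alpha> M \<longleftrightarrow> whittaker_mod q \<alpha> M \<and> simple_mod M"

definition quotm :: "'v amod \<Rightarrow> 'v set \<Rightarrow> 'v set amod" where
  "quotm M N = \<lparr> car = (\<lambda>x. (\<lambda>n. addm M x n) ` N) ` car M,
                 addm = (\<lambda>X Y. {addm M x y | x y. x \<in> X \<and> y \<in> Y}),
                 zerom = N,
                 actm = (\<lambda>r X. {addm M (actm M r x) n | x n. x \<in> X \<and> n \<in> N}) \<rparr>"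

definition coset :: "'v amod \<Rightarrow> 'v set \<Rightarrow> 'v \<Rightarrow> 'v set" where
  "coset M N x = (\<lambda>n. addm M x n) ` N"

definition regA :: "fra amod" where
  "regA = \<lparr> car = UNIV, addm = (+), zerom = 0, actm = (*) \<rparr>"

text \<open>M(eta) = U (x)_{U^+} C v_eta = U / U(E1 - alpha, E2) = fra / (I + fra(E1-alpha) + fra E2).\<close>
definition Lideal :: "complex \<Rightarrow> complex \<Rightarrow> fra set" where
  "Lideal q \<alpha> = gen_submod regA (Uideal q \<union> {E1 - sc \<alpha>, E2})"

definition Mmod :: "complex \<Rightarrow> complex \<Rightarrow> fra set amod" where
  "Mmod q \<alpha> = quotm regA (Lideal q \<alpha>)"

definition veta :: "complex \<Rightarrow> complex \<Rightarrow> fra set" where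
  "veta q \<alpha> = coset regA (Lideal q \<alpha>) 1"

definition Kel :: fra where "Kel = Kg1 * Kg2 * Kg2"
definition Kinv :: fra where "Kinv = Kg1i * Kg2i * Kg2i"
definition C1el :: "complex \<Rightarrow> fra" where
  "C1el q = F1 * E1 + sc (1 / (q - inverse q)^2) * (sc q * Kg1 + sc (inverse q) * Kg1i)"

definition CKC :: "complex \<Rightarrow> fra set" where "CKC q = subalg {Kel, Kinv, C1el q}"

definition Jid :: "complex \<Rightarrow> complex \<Rightarrow> complex \<Rightarrow> fra set" where
  "Jid q \<kappa> c = {a * (Kel - sc \<kappa>) + b * (C1el q - sc c) | a b. a \<in> CKC q \<and> b \<in> CKC q}"

definition Wsub :: "complex \<Rightarrow> complex \<Rightarrow> complex \<Rightarrow> complex \<Rightarrow> fra set set" where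
  "Wsub q \<alpha> \<kappa> c = gen_submod (Mmod q \<alpha>) {actm (Mmod q \<alpha>) j (veta q \<alpha>) | j. j \<in> Jid q \<kappa> c}"

definition Vmod :: "complex \<Rightarrow> complex \<Rightarrow> complex \<Rightarrow> complex \<Rightarrow> fra set set amod" where
  "Vmod q \<alpha> \<kappa> c = quotm (Mmod q \<alpha>) (Wsub q \<alpha> \<kappa> c)"

definition hpoly :: "complex \<Rightarrow> nat \<Rightarrow> complex \<Rightarrow> complex \<Rightarrow> complex" where
  "hpoly q n \<kappa> c = q powi (3 - 2 * int n) * \<kappa> + q powi (2 * int n - 3) * inverse \<kappa>
                      - (q - inverse q)^2 * c"

definition critical :: "complex \<Rightarrow> complex \<Rightarrow> complex \<Rightarrow> bool" where
  "critical q \<kappa> c \<longleftrightarrow> (\<exists>n::nat. n \<ge> 1 \<and> hpoly q n \<kappa> c = 0)"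

end

theory Submission imports Defs "HOL-Library.Function_Algebras" begin

text \<open>
  Modulo the left ideal generated by \<open>E1 - \<alpha>\<close>, \<open>E2\<close>, \<open>K - \<kappa>\<close>, \<open>C1 - c\<close> the algebra is spanned by
  \<open>F2^a F3^b K2^j\<close>. Reading Laurent polynomials in \<open>K2\<close> as functions on the powers of \<open>q\<close> turns
  \<open>V(\<eta>; \<kappa>, c)\<close> into an explicit space of functions \<open>h a b i\<close> graded by \<open>a + b\<close>, on which
  \<open>E2\<close> lowers the degree.
  An element of a nonzero submodule of least possible top degree \<open>m\<close> is killed by \<open>E2 E1^k\<close> for all
  \<open>k\<close>. If \<open>m \<ge> 1\<close>, evaluating this at the single point where the diagonal coefficient of \<open>E2\<close> vanishes
  forces either \<open>h_m(\<kappa>, c) = 0\<close> or the vanishing of the top component; so in the non-critical case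
  \<open>m = 0\<close>, and separating the \<open>E1\<close>-eigenvectors recovers the cyclic vector.
  Conversely, \<open>h_n(\<kappa>, c) = 0\<close> makes the equation \<open>E2 g = 0\<close> solvable by Laurent polynomials in degree
  \<open>n\<close>, and its solution \<open>g\<close> is a Whittaker vector generating a submodule in degrees \<open>\<ge> n\<close>.
\<close>

section \<open>Quotient modules\<close>

text \<open>The spanning vectors must also be linearly independent modulo the left ideal, a PBW-type
  statement inside a free algebra. Two bounds meet: straightening shows that they span, while
  operators checked against every defining relation give an annihilator \<open>Ker\<close> that
  contains the ideal and no nontrivial combination of these vectors. Functions of the exponent are
  used because each relation becomes a pointwise identity, and because a Laurent polynomial is
  determined by its values at all large exponents, so points where a coefficient vanishes can be
  discarded. The numbers h_m enter through F1 v = ff(K2) v, obtained by solving C1 v = c v. When E2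
  lands in degree n, its two coefficients at exponent i are multiples of [i - n] and of ff(q^i), and
  h_(n+1)(\<kappa>, c) = 0 says exactly that both vanish at i = n.\<close>

lemma amodD:
  assumes "is_amodule M"
  shows "zerom M \<in> car M"
    "\<And>x y. x \<in> car M \<Longrightarrow> y \<in> car M \<Longrightarrow> addm M x y \<in> car M"
    "\<And>r x. x \<in> car M \<Longrightarrow> actm M r x \<in> car M"
    "\<And>x y z. x \<in> car M \<Longrightarrow> y \<in> car M \<Longrightarrow> z \<in> car M \<Longrightarrow>
       addm M (addm M x y) z = addm M x (addm M y z)"
    "\<And>x y. x \<in> car M \<Longrightarrow> y \<in> car M \<Longrightarrow> addm M x y = addm M y x"
    "\<And>x. x \<in> car M \<Longrightarrow> addm M (zerom M) x = x"
    "\<And>x. x \<in> car M \<Longrightarrow> addm M x (zerom M) = x"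
    "\<And>x. x \<in> car M \<Longrightarrow> \<exists>y\<in>car M. addm M x y = zerom M"
    "\<And>r x y. x \<in> car M \<Longrightarrow> y \<in> car M \<Longrightarrow>
       actm M r (addm M x y) = addm M (actm M r x) (actm M r y)"
    "\<And>r s x. x \<in> car M \<Longrightarrow> actm M (r + s) x = addm M (actm M r x) (actm M s x)"
    "\<And>r s x. x \<in> car M \<Longrightarrow> actm M (r * s) x = actm M r (actm M s x)"
    "\<And>x. x \<in> car M \<Longrightarrow> actm M 1 x = x"
  using assms unfolding is_amodule_def by metis+

lemma submodD:
  assumes "submod M N"
  shows "\<And>x. x \<in> N \<Longrightarrow> x \<in> car M" "zerom M \<in> N"
    "\<And>x y. x \<in> N \<Longrightarrow> y \<in> N \<Longrightarrow> addm M x y \<in> N" "\<And>r x. x \<in> N \<Longrightarrow> actm M r x \<in> N"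
  using assms unfolding submod_def by blast+

lemma submodI:
  assumes "\<And>x. x \<in> N \<Longrightarrow> x \<in> car M" "zerom M \<in> N"
    "\<And>x y. x \<in> N \<Longrightarrow> y \<in> N \<Longrightarrow> addm M x y \<in> N" "\<And>r x. x \<in> N \<Longrightarrow> actm M r x \<in> N"
  shows "submod M N"
  using assms unfolding submod_def by blast

lemma submod_gen_submod: "S \<subseteq> car M \<Longrightarrow> is_amodule M \<Longrightarrow> submod M (gen_submod M S)"
proof (rule submodI)
  assume S: "S \<subseteq> car M" and M: "is_amodule M"
  have "submod M (car M)" by (rule submodI) (use amodD[OF M] in auto)
  thus "x \<in> car M" if "x \<in> gen_submod M S" for x
    using that S unfolding gen_submod_def by blast
qed (auto simp: gen_submod_def dest: submodD)

lemma gen_submod_superset: "S \<subseteq> gen_submod M S"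
  unfolding gen_submod_def by blast

lemma gen_submod_least: "submod M N \<Longrightarrow> S \<subseteq> N \<Longrightarrow> gen_submod M S \<subseteq> N"
  unfolding gen_submod_def by blast

locale quotient_setup =
  fixes M :: "'v amod" and N :: "'v set"
  assumes amod: "is_amodule M" and sub: "submod M N"
begin

lemmas a = amodD[OF amod]
lemmas s = submodD[OF sub]

abbreviation Q where "Q \<equiv> quotm M N"
abbreviation \<pi> where "\<pi> \<equiv> coset M N"

lemma left_cancel:
  assumes "x \<in> car M" "y \<in> car M" "z \<in> car M" "addm M x y = addm M x z"
  shows "y = z"
proof -
  obtain w where w: "w \<in> car M" "addm M x w = zerom M" using a(8) assms by blast
  have "addm M w (addm M x y) = addm M w (addm M x z)" using assms by simp
  hence "addm M (addm M w x) y = addm M (addm M w x) z" using a(4) assms w by metis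
  thus ?thesis using w a assms by metis
qed

lemma act_zero: "x \<in> car M \<Longrightarrow> actm M 0 x = zerom M"
  by (metis a(1,3,7,10) add_0 left_cancel)

text \<open>The record carries no negation; the scalar -1 of the algebra supplies inverses.\<close>

lemma neg_right: "x \<in> car M \<Longrightarrow> addm M x (actm M (-1) x) = zerom M"
  by (metis a(10,12) act_zero add.right_inverse)

lemma coset_self: "x \<in> car M \<Longrightarrow> x \<in> \<pi> x"
  unfolding coset_def using a(7) s(2) by force

lemma coset_add_right: "x \<in> car M \<Longrightarrow> n \<in> N \<Longrightarrow> \<pi> (addm M x n) = \<pi> x"
proof -
  have *: "\<pi> (addm M x n) \<subseteq> \<pi> x" if "x \<in> car M" "n \<in> N" for x n
    using that a(4) s(1,3) unfolding coset_def by (auto intro!: image_eqI)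
  assume x: "x \<in> car M" "n \<in> N"
  have n': "actm M (-1) n \<in> N" using s(4) x by blast
  have "addm M (addm M x n) (actm M (-1) n) = x"
    using x a s(1) n' neg_right by metis
  hence "\<pi> x \<subseteq> \<pi> (addm M x n)" using *[of "addm M x n" "actm M (-1) n"] x n' a(2) s(1) by force
  thus ?thesis using * x by blast
qed

lemma coset_eqI: "x \<in> car M \<Longrightarrow> y \<in> \<pi> x \<Longrightarrow> \<pi> y = \<pi> x"
  using coset_add_right by (auto simp: coset_def[of M N x])

lemma coset_zerom: "\<pi> (zerom M) = N"
  unfolding coset_def using a(6) s(1) by force

lemma coset_eq_N_iff: "x \<in> car M \<Longrightarrow> \<pi> x = N \<longleftrightarrow> x \<in> N"
  by (metis a(1) coset_eqI coset_self coset_zerom)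

lemma Q_simps: "car Q = \<pi> ` car M" "zerom Q = N"
  unfolding quotm_def coset_def by auto

lemma Q_add: "x \<in> car M \<Longrightarrow> y \<in> car M \<Longrightarrow> addm Q (\<pi> x) (\<pi> y) = \<pi> (addm M x y)"
proof -
  assume xy: "x \<in> car M" "y \<in> car M"
  have "addm M (addm M x n) (addm M y n') = addm M (addm M x y) (addm M n n')"
    if "n \<in> N" "n' \<in> N" for n n'
    using that xy a(2,4,5) s(1) by (smt (verit, ccfv_threshold))
  hence 1: "addm Q (\<pi> x) (\<pi> y) \<subseteq> \<pi> (addm M x y)"
    unfolding quotm_def coset_def using s(3) by auto
  have "addm M (addm M x y) n = addm M x (addm M y n)" if "n \<in> N" for n
    using that xy a(4) s(1) by metis
  hence "\<pi> (addm M x y) \<subseteq> addm Q (\<pi> x) (\<pi> y)"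
    using coset_self[OF xy(1)] unfolding quotm_def coset_def by auto
  with 1 show ?thesis by blast
qed

lemma Q_act: "x \<in> car M \<Longrightarrow> actm Q r (\<pi> x) = \<pi> (actm M r x)"
proof -
  assume x: "x \<in> car M"
  have "addm M (actm M r (addm M x n)) n' = addm M (actm M r x) (addm M (actm M r n) n')"
    if "n \<in> N" "n' \<in> N" for n n'
    using that x a(3,4,9) s(1) by metis
  hence 1: "actm Q r (\<pi> x) \<subseteq> \<pi> (actm M r x)"
    unfolding quotm_def coset_def using s(3,4) by auto
  have "\<pi> (actm M r x) \<subseteq> actm Q r (\<pi> x)"
    using coset_self[OF x] unfolding quotm_def coset_def by auto
  with 1 show ?thesis by blast
qed

lemma amodule_Q: "is_amodule Q"
  unfolding is_amodule_def Q_simps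
proof (intro conjI ballI allI; (elim imageE)?)
  show "N \<in> \<pi> ` car M" using coset_zerom a(1) by blast
  show "addm Q x y \<in> \<pi> ` car M" if "x = \<pi> u" "u \<in> car M" "y = \<pi> v" "v \<in> car M" for x y u v
    using that Q_add a(2) by auto
  show "actm Q r x \<in> \<pi> ` car M" if "x = \<pi> u" "u \<in> car M" for r x u
    using that Q_act a(3) by auto
  show "addm Q (addm Q x y) z = addm Q x (addm Q y z)"
    if "x = \<pi> u" "u \<in> car M" "y = \<pi> v" "v \<in> car M" "z = \<pi> w" "w \<in> car M" for x y z u v w
    using that by (simp add: Q_add a(2,4))
  show "addm Q x y = addm Q y x" if "x = \<pi> u" "u \<in> car M" "y = \<pi> v" "v \<in> car M" for x y u v
    using that a(5)[of u v] by (simp add: Q_add)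
  show "addm Q N x = x" if "x = \<pi> u" "u \<in> car M" for x u
    using that Q_add[of "zerom M" u] a(1,6) by (simp add: coset_zerom)
  show "\<exists>y\<in>\<pi> ` car M. addm Q x y = N" if "x = \<pi> u" "u \<in> car M" for x u
    using that a(3) by (auto simp: Q_add neg_right coset_zerom intro!: bexI[of _ "actm M (-1) u"])
  show "actm Q r (addm Q x y) = addm Q (actm Q r x) (actm Q r y)"
    if "x = \<pi> u" "u \<in> car M" "y = \<pi> v" "v \<in> car M" for r x y u v
    using that by (simp add: Q_add Q_act a(2,3,9,10))
  show "actm Q (r + t) x = addm Q (actm Q r x) (actm Q t x)" if "x = \<pi> u" "u \<in> car M" for r t x u
    using that by (simp add: Q_add Q_act a(2,3,9,10))
  show "actm Q (r * t) x = actm Q r (actm Q t x)" if "x = \<pi> u" "u \<in> car M" for r t x u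
    using that by (simp add: Q_act a(3,11,12))
  show "actm Q 1 x = x" if "x = \<pi> u" "u \<in> car M" for x u
    using that by (simp add: Q_act a(3,11,12))
qed

definition pre :: "'v set set \<Rightarrow> 'v set" where "pre P = {x \<in> car M. \<pi> x \<in> P}"

lemma submod_image: "submod M N' \<Longrightarrow> submod Q (\<pi> ` N')"
proof (rule submodI; (elim imageE)?)
  assume n: "submod M N'"
  note d = submodD[OF n]
  show "zerom Q \<in> \<pi> ` N'" using coset_zerom d(2) unfolding Q_simps by blast
  show "x \<in> car Q" if "x = \<pi> u" "u \<in> N'" for x u using that d(1) unfolding Q_simps by blast
  show "addm Q x y \<in> \<pi> ` N'" if "x = \<pi> u" "u \<in> N'" "y = \<pi> v" "v \<in> N'" for x y u v
    using that d by (simp add: Q_add)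
  show "actm Q r x \<in> \<pi> ` N'" if "x = \<pi> u" "u \<in> N'" for r x u
    using that d by (simp add: Q_act)
qed

lemma submod_pre: "submod Q P \<Longrightarrow> submod M (pre P)"
proof (rule submodI)
  assume P: "submod Q P"
  note d = submodD[OF P]
  show "x \<in> car M" if "x \<in> pre P" for x using that unfolding pre_def by simp
  show "zerom M \<in> pre P" using d(2) a(1) coset_zerom unfolding pre_def Q_simps by simp
  show "addm M x y \<in> pre P" if "x \<in> pre P" "y \<in> pre P" for x y
    using that d(3)[of "\<pi> x" "\<pi> y"] a(2) unfolding pre_def by (simp add: Q_add)
  show "actm M r x \<in> pre P" if "x \<in> pre P" for r x
    using that d(4)[of "\<pi> x" r] a(3) unfolding pre_def by (simp add: Q_act)
qed

lemma pre_superset: "submod Q P \<Longrightarrow> N \<subseteq> pre P"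
proof
  fix x assume "submod Q P" "x \<in> N"
  moreover have "\<pi> x = N" using coset_eq_N_iff s(1) \<open>x \<in> N\<close> by blast
  ultimately show "x \<in> pre P" using submodD(2)[of Q P] s(1) unfolding pre_def Q_simps by simp
qed

lemma image_pre: "submod Q P \<Longrightarrow> \<pi> ` pre P = P"
proof -
  assume "submod Q P"
  hence "P \<subseteq> \<pi> ` car M" using submodD(1)[of Q P] unfolding Q_simps by blast
  thus ?thesis unfolding pre_def by blast
qed

lemma pre_image:
  assumes "submod M N'" "N \<subseteq> N'"
  shows "pre (\<pi> ` N') = N'"
proof -
  have "x \<in> N'" if "x \<in> car M" "\<pi> x = \<pi> y" "y \<in> N'" for x y
  proof -
    have "x \<in> \<pi> y" using coset_self that by metis
    then obtain n where "n \<in> N" "x = addm M y n" unfolding coset_def by blast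
    thus ?thesis using assms(2) submodD(3)[OF assms(1) that(3), of n] by blast
  qed
  moreover have "N' \<subseteq> car M" using submodD(1)[OF assms(1)] by blast
  ultimately show ?thesis unfolding pre_def by blast
qed

lemma pre_car: "pre (car Q) = car M"
  unfolding pre_def Q_simps by auto

text \<open>The correspondence theorem: \<open>pre\<close> and the image under the projection are
  mutually inverse between submodules of the quotient and submodules containing \<open>N\<close>,
  and both preserve inclusion.\<close>

lemma maximal_quotient_iff:
  assumes P: "submod Q P"
  shows "maximal_submod Q P \<longleftrightarrow> maximal_submod M (pre P)"
proof
  assume m: "maximal_submod Q P"
  show "maximal_submod M (pre P)"
    unfolding maximal_submod_def
  proof (intro conjI allI impI)
    show "submod M (pre P)" by (rule submod_pre[OF P])
    show "pre P \<noteq> car M"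
      using m image_pre[OF P] unfolding maximal_submod_def Q_simps by metis
    fix N' assume n: "submod M N' \<and> pre P \<subseteq> N'"
    hence "P \<subseteq> \<pi> ` N'" using image_pre[OF P] by blast
    hence "\<pi> ` N' = P \<or> \<pi> ` N' = car Q" using m n submod_image unfolding maximal_submod_def by blast
    thus "N' = pre P \<or> N' = car M"
      using n pre_image[of N'] pre_superset[OF P] pre_car by force
  qed
next
  assume m: "maximal_submod M (pre P)"
  show "maximal_submod Q P"
    unfolding maximal_submod_def
  proof (intro conjI allI impI)
    show "submod Q P" by fact
    show "P \<noteq> car Q" using m pre_car unfolding maximal_submod_def by metis
    fix P' assume p: "submod Q P' \<and> P \<subseteq> P'"
    hence "pre P \<subseteq> pre P'" unfolding pre_def by blast
    hence "pre P' = pre P \<or> pre P' = car M" using m p submod_pre unfolding maximal_submod_def by blast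
    thus "P' = P \<or> P' = car Q" using image_pre P p Q_simps(1) by metis
  qed
qed

text \<open>The zero submodule of the quotient is \<open>{N}\<close> with preimage \<open>N\<close>,
  so this is the correspondence theorem at the zero submodule.\<close>

lemma simple_quotient_iff: "simple_mod Q \<longleftrightarrow> maximal_submod M N"
proof -
  have z: "submod Q {N}"
  proof -
    have "\<pi> ` N = {N}" using coset_eq_N_iff s(1,2) by blast
    thus ?thesis using submod_image[OF sub] by simp
  qed
  have "pre {N} = N" using coset_eq_N_iff s(1) unfolding pre_def by blast
  moreover have "simple_mod Q \<longleftrightarrow> maximal_submod Q {N}"
    using z submodD(2)[of Q] unfolding simple_mod_def maximal_submod_def Q_simps by blast
  ultimately show ?thesis using maximal_quotient_iff[OF z] by simp
qed

lemma Umodule_Q: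
  assumes "\<And>r x. r \<in> Urels q \<Longrightarrow> x \<in> car M \<Longrightarrow> actm M r x \<in> N"
  shows "is_Umodule q Q"
  unfolding is_Umodule_def using amodule_Q assms by (auto simp: Q_simps Q_act a(3) coset_eq_N_iff)

end

lemma amodule_regA: "is_amodule regA"
proof -
  have "\<exists>y. x + y = 0" for x :: fra using add.right_inverse by blast
  thus ?thesis unfolding is_amodule_def regA_def by (simp add: algebra_simps)
qed

section \<open>The representation on functions\<close>

lemma fra_single_induct [case_names single add]:
  fixes u :: fra
  assumes "\<And>w k. P (Poly_Mapping.single w k)" "\<And>u v. P u \<Longrightarrow> P v \<Longrightarrow> P (u + v)"
  shows "P u"
proof (induction u rule: update_induct)
  case const
  show ?case using assms(1)[of 0 0] by simp
next
  case (update f a b)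
  have "Poly_Mapping.update a b f = f + Poly_Mapping.single a b"
    by (rule poly_mapping_eqI) (use update in \<open>auto simp:
        lookup_update lookup_add lookup_single in_keys_iff\<close>)
  thus ?case using assms update by simp
qed

lemma single_Nil: "Poly_Mapping.single (Wd []) k = sc k"
  unfolding sc_def zero_word_def ..

lemma single_Cons: "Poly_Mapping.single (Wd (g # l)) k = gn g * Poly_Mapping.single (Wd l) k"
  unfolding gn_def mult_single by simp

text \<open>Used for closure under the whole algebra: stability under single generators suffices,
  since words grow by one letter on the left.\<close>

lemma fra_left_induct [case_names sc add gen]:
  assumes "\<And>k. P (sc k)" "\<And>u v. P u \<Longrightarrow> P v \<Longrightarrow> P (u + v)" "\<And>g u. P u \<Longrightarrow> P (gn g * u)"
  shows "P u"
proof (induction u rule: fra_single_induct)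
  case (single w k)
  obtain l where "w = Wd l" by (cases w)
  moreover have "P (Poly_Mapping.single (Wd l) k)"
    by (induction l) (use assms in \<open>simp_all add: single_Nil single_Cons\<close>)
  ultimately show ?case by simp
qed (use assms in blast)

lemma sc_simps: "sc 0 = 0" "sc 1 = 1" "sc (a + b) = sc a + sc b" "sc (a * b) = sc a * sc b"
  "sc (- a) = - sc a" "sc (a - b) = sc a - sc b"
  unfolding sc_def by (simp_all add: single_add mult_single single_diff single_uminus)

lemma sc_commute: "sc k * u = u * sc k"
proof (induction u rule: fra_single_induct)
  case (single w r)
  show ?case unfolding sc_def mult_single by (simp add: mult.commute)
qed (simp add: algebra_simps)

type_synonym cfun = "nat \<Rightarrow> nat \<Rightarrow> int \<Rightarrow> complex"

definition scl :: "complex \<Rightarrow> cfun \<Rightarrow> cfun" where "scl k h = (\<lambda>a b i. k * h a b i)"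

lemma scl_simps [simp]: "scl k h a b i = k * h a b i" "scl 1 h = h" "scl 0 h = 0" "scl k 0 = 0"
  "scl k (scl l h) = scl (k * l) h"
  unfolding scl_def by (auto simp: fun_eq_iff mult.assoc)

locale whittaker_params =
  fixes q \<alpha> \<kappa> c :: complex
  assumes q0: "q \<noteq> 0" and nru: "\<And>n::nat. n \<ge> 1 \<Longrightarrow> q ^ n \<noteq> 1" and \<alpha>0: "\<alpha> \<noteq> 0" and \<kappa>0: "\<kappa> \<noteq> 0"
begin

text \<open>At \<open>t = q^n\<close> this is the quantum integer [n]. Taking t rather than n as the
  argument keeps the operator identities rational in q^a, q^b and q^i.\<close>

definition br :: "complex \<Rightarrow> complex" where "br t = (t - 1 / t) / (q - 1 / q)"

text \<open>Since E1 acts on v by \<alpha> and K1 by \<kappa> K2^(-2), solving C1 v = c v gives F1 v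
  = ff(K2) v.\<close>

definition ff :: "complex \<Rightarrow> complex" where
  "ff x = (c - (\<kappa> * q / x^2 + x^2 / (\<kappa> * q)) / (q - 1 / q)^2) / \<alpha>"

text \<open>The function \<open>h\<close> stands for the formal sum of the vectors
  \<open>F2^a F3^b p\<^sub>a\<^sub>b(K2) v / ([a]! [b]!)\<close> with \<open>F3 = F2 F1 - q F1 F2\<close>, where \<open>h a b i\<close> is the value of
  the Laurent polynomial \<open>p\<^sub>a\<^sub>b\<close> at \<open>q^i\<close>. The truncated \<open>a - 1\<close> and \<open>b - 1\<close> are harmless because
  \<open>br 1 = 0\<close>.\<close>
fun opg :: "gen \<Rightarrow> cfun \<Rightarrow> cfun" where
  "opg GK2 h = (\<lambda>a b i. q powi i / (q^a * q^a * q^b) * h a b i)"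
| "opg GK2i h = (\<lambda>a b i. (q^a * q^a * q^b) / (q powi i) * h a b i)"
| "opg GK1 h = (\<lambda>a b i. \<kappa> * q^a / (q^b * (q powi i)^2) * h a b i)"
| "opg GK1i h = (\<lambda>a b i. q^b * (q powi i)^2 / (\<kappa> * q^a) * h a b i)"
| "opg GE1 h = (\<lambda>a b i. \<alpha> * h a b (i + 1) - \<kappa> * q / (q powi i)^2 * br (q^a) * h (a - 1) (b + 1) i)"
| "opg GE2 h = (\<lambda>a b i. br (q powi i / (q^a * q^b)) * h (a + 1) b i
      + q^b * q / (q powi i) * ff (q powi i) * h a (b + 1) (i - 1))"
| "opg GF1 h = (\<lambda>a b i. q^b / q^a * ff (q powi i) * h a b (i - 1) - br (q^b) / q * h (a + 1) (b - 1) i)"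
| "opg GF2 h = (\<lambda>a b i. br (q^a) * h (a - 1) b i)"

primrec opw :: "gen list \<Rightarrow> cfun \<Rightarrow> cfun" where
  "opw [] h = h"
| "opw (g # l) h = opg g (opw l h)"

definition act :: "fra \<Rightarrow> cfun \<Rightarrow> cfun" where
  "act u h = (\<lambda>a b i. \<Sum>w\<in>Poly_Mapping.keys u. Poly_Mapping.lookup u w
      * opw (case w of Wd l \<Rightarrow> l) h a b i)"

lemma opg_add: "opg g (h + h') = opg g h + opg g h'"
  by (cases g; intro ext; simp add: algebra_simps add_divide_distrib)

lemma opg_scl: "opg g (scl k h) = scl k (opg g h)"
  by (cases g; intro ext; simp add: algebra_simps)

lemma opw_add: "opw l (h + h') = opw l h + opw l h'"
  by (induction l) (simp_all only: opw.simps opg_add)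

lemma opw_scl: "opw l (scl k h) = scl k (opw l h)"
  by (induction l) (simp_all only: opw.simps opg_scl)

text \<open>Two elements have different supports; a common finite index set makes their sums
  comparable term by term.\<close>

lemma act_superset:
  assumes "finite S" "Poly_Mapping.keys u \<subseteq> S"
  shows "act u h a b i = (\<Sum>w\<in>S. Poly_Mapping.lookup u w * opw (case w of Wd l \<Rightarrow> l) h a b i)"
  unfolding act_def using assms by (intro sum.mono_neutral_left) (auto simp: in_keys_iff)

lemma act_add: "act (u + v) h = act u h + act v h"
proof (intro ext)
  fix a b i
  let ?S = "Poly_Mapping.keys u \<union> Poly_Mapping.keys v"
  have "Poly_Mapping.keys (u + v) \<subseteq> ?S" by (rule keys_add)
  thus "act (u + v) h a b i = (act u h + act v h) a b i"
    by (simp add: act_superset[of ?S] lookup_add sum.distrib ring_distribs)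
qed

lemma act_single: "act (Poly_Mapping.single (Wd l) k) h = scl k (opw l h)"
  by (intro ext) (simp add: act_superset[of "{Wd l}"] lookup_single)

lemma act_right_add: "act u (h + h') = act u h + act u h'"
  unfolding act_def by (intro ext) (simp add: opw_add sum.distrib ring_distribs)

lemma act_right_scl: "act u (scl k h) = scl k (act u h)"
  unfolding act_def by (intro ext) (simp add: opw_scl sum_distrib_left mult_ac)

lemma act_sc: "act (sc k) h = scl k h"
  using act_single[of "[]"] by (simp add: single_Nil)

lemma act_gn: "act (gn g) h = opg g h"
  using act_single[of "[g]" 1] by (simp add: gn_def)

lemma opw_append: "opw (l @ l') h = opw l (opw l' h)"
  by (induction l) simp_all

lemma act_mult: "act (u * v) h = act u (act v h)"
proof (induction u rule: fra_single_induct)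
  case (single w k)
  show ?case
  proof (induction v rule: fra_single_induct)
    case (single w' k')
    show ?case
      by (cases w; cases w') (simp only:
      mult_single act_single opw_append opw_scl scl_simps(5) plus_word.simps)
  qed (simp only: ring_distribs act_add act_right_add)
qed (simp only: ring_distribs act_add act_right_add)

lemma act_uminus: "act (- u) h = - act u h"
  unfolding act_def by (intro ext) (simp add: sum_negf)

lemma act_diff: "act (u - v) h = act u h - act v h"
  using act_add[of u "- v"] act_uminus by simp

lemma act_0: "act 0 h = 0"
  unfolding act_def by (auto simp: fun_eq_iff)

lemma act_right_0: "act u 0 = 0"
  using act_right_scl[of u 0] by simp

lemma act_1: "act 1 h = h"
  using act_sc[of 1] by (simp add: sc_simps)

lemmas act_simps = act_add act_diff act_uminus act_mult act_0 act_1 act_sc act_gn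

lemma qq: "q * q \<noteq> 1" "q\<^sup>2 \<noteq> 1" "q - 1 / q \<noteq> 0"
proof -
  show *: "q * q \<noteq> 1" "q\<^sup>2 \<noteq> 1" using nru[of 2] by (simp_all add: power2_eq_square)
  show "q - 1 / q \<noteq> 0" using q0 * by (simp add: field_simps)
qed

lemma qx: "q powi i \<noteq> 0" using q0 by simp

lemma powi_shift: "q powi (i + 1) = q powi i * q" "q powi (i - 1) = q powi i / q"
  using q0 by (simp_all add: power_int_add_1 power_int_diff)

end

section \<open>Verification of the defining relations\<close>

context whittaker_params begin
lemma br_1 [simp]: "br 1 = 0"
  unfolding br_def by simp

text \<open>Evaluated at \<open>a b i\<close>, each Serre relation is a combination of at most four shifted values of
  \<open>h\<close>. Their coefficients, written with \<open>x\<close>, \<open>y\<close>, \<open>z\<close> for \<open>q^i\<close>, \<open>q^a\<close>, \<open>q^b\<close>, vanish separately;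
  keeping \<open>DD\<close> opaque makes them polynomial identities of manageable size.\<close>
definition DD where "DD = 1 / (q - 1 / q)"
definition ce where "ce x y = - (\<kappa> * q / x\<^sup>2 * br y)"
definition cp where "cp x y z = br (x / (y * z))"
definition cr where "cr z x = z * q / x * ff x"
definition cu where "cu x y z = z / y * ff x"
definition cv where "cv z = - (br z / q)"
lemma br_alt: "br t = (t - 1 / t) * DD" unfolding br_def DD_def by simp
lemma ff_alt: "ff x = (c - (\<kappa> * q / x\<^sup>2 + x\<^sup>2 / (\<kappa> * q)) * DD\<^sup>2) / \<alpha>"
  unfolding ff_def DD_def by (simp add: field_simps)

lemma serre_E12_coeff_0:
  assumes "x \<noteq> 0" "y \<noteq> 0" "z \<noteq> 0"
  shows "(\<alpha>*\<alpha>*cp (x*q*q) y z) + (cp x y z*\<alpha>*\<alpha>) - (q + inverse q) * (\<alpha>*cp (x*q) y z*\<alpha>) = 0"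
  using assms q0 \<kappa>0 \<alpha>0
  apply (simp add: ce_def cp_def cr_def cu_def cv_def br_alt )
  apply (simp add: divide_simps)?
  apply (simp add: algebra_simps eval_nat_numeral)?
  done

lemma serre_E12_coeff_1:
  assumes "x \<noteq> 0" "y \<noteq> 0" "z \<noteq> 0"
  shows "(\<alpha>*\<alpha>*cr z (x*q*q) + \<alpha>*ce (x*q) y*cp (x*q) (y/q) (z*q) + ce x y*\<alpha>
      *cp (x*q) (y/q) (z*q)) + (cp x y z*\<alpha>*ce (x*q) (y*q) + cp x y z*ce x (y*q)*\<alpha>
      + cr z x*\<alpha>*\<alpha>) - (q + inverse q) * (\<alpha>*cp (x*q) y z*ce (x*q) (y*q) + \<alpha>*cr z (x*q)*\<alpha>
      + ce x y*cp x (y/q) (z*q)*\<alpha>) = 0"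
  using assms q0 \<kappa>0 \<alpha>0
  apply (simp add: ce_def cp_def cr_def cu_def cv_def br_alt ff_alt)
  apply (simp add: divide_simps)?
  apply (simp add: algebra_simps eval_nat_numeral)?
  done

lemma serre_E12_coeff_2:
  assumes "x \<noteq> 0" "y \<noteq> 0" "z \<noteq> 0"
  shows "(\<alpha>*ce (x*q) y*cr (z*q) (x*q) + ce x y*\<alpha>*cr (z*q) (x*q) + ce x y*ce x (y/q)
      *cp x (y/q/q) (z*q*q)) + (cp x y z*ce x (y*q)*ce x y + cr z x*\<alpha>*ce x y
      + cr z x*ce (x/q) y*\<alpha>) - (q + inverse q) * (\<alpha>*cr z (x*q)*ce x y + ce x y
      *cp x (y/q) (z*q)*ce x y + ce x y*cr (z*q) x*\<alpha>) = 0"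
  using assms q0 \<kappa>0 \<alpha>0
  apply (simp add: ce_def cp_def cr_def cu_def cv_def br_alt )
  apply (simp add: divide_simps)?
  apply (simp add: algebra_simps eval_nat_numeral)?
  done

lemma serre_E12_coeff_3:
  assumes "x \<noteq> 0" "y \<noteq> 0" "z \<noteq> 0"
  shows "(ce x y*ce x (y/q)*cr (z*q*q) x) + (cr z x*ce (x/q) y*ce (x/q) (y/q)) - (q
      + inverse q) * (ce x y*cr (z*q) x*ce (x/q) (y/q)) = 0"
  using assms q0 \<kappa>0 \<alpha>0
  apply (simp add: ce_def cp_def cr_def cu_def cv_def br_alt )
  apply (simp add: divide_simps)?
  apply (simp add: algebra_simps eval_nat_numeral)?
  done

lemma serre_E21_coeff_0:
  assumes "x \<noteq> 0" "y \<noteq> 0" "z \<noteq> 0"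
  shows "(cp x y z*cp x (y*q) z*\<alpha>) + (\<alpha>*cp (x*q) y z*cp (x*q) (y*q) z) - (q
      + inverse q) * (cp x y z*\<alpha>*cp (x*q) (y*q) z) = 0"
  using assms q0 \<kappa>0 \<alpha>0
  apply (simp add: ce_def cp_def cr_def cu_def cv_def br_alt )
  apply (simp add: divide_simps)?
  apply (simp add: algebra_simps eval_nat_numeral)?
  done

lemma serre_E21_coeff_1:
  assumes "x \<noteq> 0" "y \<noteq> 0" "z \<noteq> 0"
  shows "(cp x y z*cp x (y*q) z*ce x (y*q*q) + cp x y z*cr z x*\<alpha> + cr z x
      *cp (x/q) y (z*q)*\<alpha>) + (\<alpha>*cp (x*q) y z*cr z (x*q) + \<alpha>*cr z (x*q)*cp x y (z*q)
      + ce x y*cp x (y/q) (z*q)*cp x y (z*q)) - (q + inverse q) * (cp x y z*\<alpha>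
      *cr z (x*q) + cp x y z*ce x (y*q)*cp x y (z*q) + cr z x*\<alpha>*cp x y (z*q)) = 0"
  using assms q0 \<kappa>0 \<alpha>0
  apply (simp add: ce_def cp_def cr_def cu_def cv_def br_alt ff_alt)
  apply (simp add: divide_simps)?
  apply (simp add: algebra_simps eval_nat_numeral)?
  done

lemma serre_E21_coeff_2:
  assumes "x \<noteq> 0" "y \<noteq> 0" "z \<noteq> 0"
  shows "(cp x y z*cr z x*ce (x/q) (y*q) + cr z x*cp (x/q) y (z*q)*ce (x/q) (y*q)
      + cr z x*cr (z*q) (x/q)*\<alpha>) + (\<alpha>*cr z (x*q)*cr (z*q) x + ce x y*cp x (y/q) (z*q)
      *cr (z*q) x + ce x y*cr (z*q) x*cp (x/q) (y/q) (z*q*q)) - (q + inverse q)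
      * (cp x y z*ce x (y*q)*cr (z*q) x + cr z x*\<alpha>*cr (z*q) x + cr z x
      *ce (x/q) y*cp (x/q) (y/q) (z*q*q)) = 0"
  using assms q0 \<kappa>0 \<alpha>0
  apply (simp add: ce_def cp_def cr_def cu_def cv_def br_alt ff_alt)
  apply (simp add: divide_simps)?
  apply (simp add: algebra_simps eval_nat_numeral)?
  done

lemma serre_E21_coeff_3:
  assumes "x \<noteq> 0" "y \<noteq> 0" "z \<noteq> 0"
  shows "(cr z x*cr (z*q) (x/q)*ce (x/q/q) y) + (ce x y*cr (z*q) x*cr (z*q*q) (x/q))
      - (q + inverse q) * (cr z x*ce (x/q) y*cr (z*q*q) (x/q)) = 0"
  using assms q0 \<kappa>0 \<alpha>0
  apply (simp add: ce_def cp_def cr_def cu_def cv_def br_alt )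
  apply (simp add: divide_simps)?
  apply (simp add: algebra_simps eval_nat_numeral)?
  done

lemma serre_F12_coeff_0:
  assumes "x \<noteq> 0" "y \<noteq> 0" "z \<noteq> 0"
  shows "(cv z*cv (z/q)*br (y*q*q)) + (br y*cv z*cv (z/q)) - (q + inverse q) * (cv z
      *br (y*q)*cv (z/q)) = 0"
  using assms q0 \<kappa>0 \<alpha>0
  apply (simp add: ce_def cp_def cr_def cu_def cv_def br_alt )
  apply (simp add: divide_simps)?
  apply (simp add: algebra_simps eval_nat_numeral)?
  done

lemma serre_F12_coeff_1:
  assumes "x \<noteq> 0" "y \<noteq> 0" "z \<noteq> 0"
  shows "(cu x y z*cv z*br (y*q) + cv z*cu x (y*q) (z/q)*br (y*q)) + (br y
      *cu x (y/q) z*cv z + br y*cv z*cu x y (z/q)) - (q + inverse q) * (cu x y z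
      *br y*cv z + cv z*br (y*q)*cu x y (z/q)) = 0"
  using assms q0 \<kappa>0 \<alpha>0
  apply (simp add: ce_def cp_def cr_def cu_def cv_def br_alt )
  apply (simp add: divide_simps)?
  apply (simp add: algebra_simps eval_nat_numeral)?
  done

lemma serre_F12_coeff_2:
  assumes "x \<noteq> 0" "y \<noteq> 0" "z \<noteq> 0"
  shows "(cu x y z*cu (x/q) y z*br y) + (br y*cu x (y/q) z*cu (x/q) (y/q) z)
      - (q + inverse q) * (cu x y z*br y*cu (x/q) (y/q) z) = 0"
  using assms q0 \<kappa>0 \<alpha>0
  apply (simp add: ce_def cp_def cr_def cu_def cv_def br_alt )
  apply (simp add: divide_simps)?
  apply (simp add: algebra_simps eval_nat_numeral)?
  done

lemma ce_1 [simp]: "ce x 1 = 0" unfolding ce_def by simp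
lemma cv_1 [simp]: "cv 1 = 0" unfolding cv_def by simp
lemma powi_shift2: "q powi (i + 2) = q powi i * q * q" "q powi (i - 2) = q powi i / q / q"
  using q0 by (simp_all add: power_int_add power_int_diff power2_eq_square)
lemma op_alt:
  "opg GE1 h a b i = \<alpha> * h a b (i + 1) + ce (q powi i) (q^a) * h (a - 1) (b + 1) i"
  "opg GE2 h a b i = cp (q powi i) (q^a) (q^b) * h (a + 1) b i + cr (q^b) (q powi i) * h a (b
      + 1) (i - 1)"
  "opg GF1 h a b i = cu (q powi i) (q^a) (q^b) * h a b (i - 1) + cv (q^b) * h (a + 1) (b - 1) i"
  unfolding ce_def cp_def cr_def cu_def cv_def by simp_all

lemma serre_E12: "act (E1 * E1 * E2) h + act (E2 * E1 * E1) h = scl (q + inverse q) (act (E1 * E2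
    * E1) h)"
proof (intro ext)
  fix a b i
  define x y z where xyz: "x = q powi i" "y = q ^ a" "z = q ^ b"
  have n: "x \<noteq> 0" "y \<noteq> 0" "z \<noteq> 0" using q0 xyz by auto
  \<comment> \<open>The cases a = 0, a = 1 and a \<ge> 2 are separated because E1 lowers a by
    truncated subtraction. For small a, the coefficients of the values at a - 1 or a - 2 contain a
    factor \<open>ce x 1 = 0\<close>.\<close>
  have r: "act (E1 * E1 * E2) h a b i + act (E2 * E1 * E1) h a b i
     - (q + inverse q) * act (E1 * E2 * E1) h a b i = ((\<alpha>*\<alpha>*cp (x*q*q) y z)
         + (cp x y z*\<alpha>*\<alpha>) - (q + inverse q) * (\<alpha>*cp (x*q) y z*\<alpha>)) * h (a + 1) b (i + 2)
         + ((\<alpha>*\<alpha>*cr z (x*q*q) + \<alpha>*ce (x*q) y*cp (x*q) (y/q) (z*q) + ce x y*\<alpha>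
         *cp (x*q) (y/q) (z*q)) + (cp x y z*\<alpha>*ce (x*q) (y*q) + cp x y z*ce x (y*q)*\<alpha>
         + cr z x*\<alpha>*\<alpha>) - (q + inverse q) * (\<alpha>*cp (x*q) y z*ce (x*q) (y*q) + \<alpha>*cr z (x*q)*\<alpha>
         + ce x y*cp x (y/q) (z*q)*\<alpha>)) * h a (Suc (b)) (i + 1) + ((\<alpha>*ce (x*q) y
         *cr (z*q) (x*q) + ce x y*\<alpha>*cr (z*q) (x*q) + ce x y*ce x (y/q)
         *cp x (y/q/q) (z*q*q)) + (cp x y z*ce x (y*q)*ce x y + cr z x*\<alpha>
         *ce x y + cr z x*ce (x/q) y*\<alpha>) - (q + inverse q) * (\<alpha>*cr z (x*q)*ce x y
         + ce x y*cp x (y/q) (z*q)*ce x y + ce x y*cr (z*q) x*\<alpha>)) * h (a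
         - 1) (Suc (Suc (b))) i + ((ce x y*ce x (y/q)*cr (z*q*q) x) + (cr z x
         *ce (x/q) y*ce (x/q) (y/q)) - (q + inverse q) * (ce x y*cr (z*q) x*ce (x/q) (y/q)))
         * h (a - 2) (Suc (Suc (Suc (b)))) (i - 1)" (is "?L = ?R")
  proof (cases a)
    case 0
    thus ?thesis using n q0
      by (simp add: act_simps op_alt powi_shift powi_shift2 xyz del: opg.simps(5-7), simp add:
      powi_shift2 algebra_simps)
  next
    case (Suc n)
    thus ?thesis
    proof (cases n)
      case 0
      thus ?thesis using Suc n q0 xyz
        by (simp add: act_simps op_alt powi_shift powi_shift2 xyz del: opg.simps(5-7), simp add:
        powi_shift2 algebra_simps)
    next
      case (Suc m)
      thus ?thesis using \<open>a = Suc n\<close> n q0 xyz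
        by (simp add: act_simps op_alt powi_shift powi_shift2 xyz del: opg.simps(5-7), simp add:
        powi_shift2 algebra_simps)
    qed
  qed
  moreover have "?R = 0" using serre_E12_coeff_0[OF n] serre_E12_coeff_1[OF n]
      serre_E12_coeff_2[OF n] serre_E12_coeff_3[OF n] by simp
  ultimately show "(act (E1 * E1 * E2) h + act (E2 * E1 * E1) h) a b i
     = scl (q + inverse q) (act (E1 * E2 * E1) h) a b i" by simp
qed

lemma serre_E21: "act (E2 * E2 * E1) h + act (E1 * E2 * E2) h = scl (q + inverse q) (act (E2 * E1
    * E2) h)"
proof (intro ext)
  fix a b i
  define x y z where xyz: "x = q powi i" "y = q ^ a" "z = q ^ b"
  have n: "x \<noteq> 0" "y \<noteq> 0" "z \<noteq> 0" using q0 xyz by auto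
  have r: "act (E2 * E2 * E1) h a b i + act (E1 * E2 * E2) h a b i
     - (q + inverse q) * act (E2 * E1 * E2) h a b i = ((cp x y z*cp x (y*q) z*\<alpha>) + (\<alpha>
         *cp (x*q) y z*cp (x*q) (y*q) z) - (q + inverse q) * (cp x y z*\<alpha>
         *cp (x*q) (y*q) z)) * h (a + 2) b (i + 1) + ((cp x y z*cp x (y*q) z
         *ce x (y*q*q) + cp x y z*cr z x*\<alpha> + cr z x*cp (x/q) y (z*q)*\<alpha>) + (\<alpha>
         *cp (x*q) y z*cr z (x*q) + \<alpha>*cr z (x*q)*cp x y (z*q) + ce x y
         *cp x (y/q) (z*q)*cp x y (z*q)) - (q + inverse q) * (cp x y z*\<alpha>*cr z (x*q)
         + cp x y z*ce x (y*q)*cp x y (z*q) + cr z x*\<alpha>*cp x y (z*q))) * h (a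
         + 1) (Suc (b)) i + ((cp x y z*cr z x*ce (x/q) (y*q) + cr z x
         *cp (x/q) y (z*q)*ce (x/q) (y*q) + cr z x*cr (z*q) (x/q)*\<alpha>) + (\<alpha>*cr z (x*q)
         *cr (z*q) x + ce x y*cp x (y/q) (z*q)*cr (z*q) x + ce x y*cr (z*q) x
         *cp (x/q) (y/q) (z*q*q)) - (q + inverse q) * (cp x y z*ce x (y*q)*cr (z*q) x
         + cr z x*\<alpha>*cr (z*q) x + cr z x*ce (x/q) y*cp (x/q) (y/q) (z*q*q)))
         * h a (Suc (Suc (b))) (i - 1) + ((cr z x*cr (z*q) (x/q)*ce (x/q/q) y) + (ce x y
         *cr (z*q) x*cr (z*q*q) (x/q)) - (q + inverse q) * (cr z x*ce (x/q) y
         *cr (z*q*q) (x/q))) * h (a - 1) (Suc (Suc (Suc (b)))) (i - 2)" (is "?L = ?R")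
  proof (cases a)
    case 0
    thus ?thesis using n q0
      by (simp add: act_simps op_alt powi_shift powi_shift2 xyz del: opg.simps(5-7), simp add:
      powi_shift2 algebra_simps)
  next
    case (Suc n)
    thus ?thesis
    proof (cases n)
      case 0
      thus ?thesis using Suc n q0 xyz
        by (simp add: act_simps op_alt powi_shift powi_shift2 xyz del: opg.simps(5-7), simp add:
        powi_shift2 algebra_simps)
    next
      case (Suc m)
      thus ?thesis using \<open>a = Suc n\<close> n q0 xyz
        by (simp add: act_simps op_alt powi_shift powi_shift2 xyz del: opg.simps(5-7), simp add:
        powi_shift2 algebra_simps)
    qed
  qed
  moreover have "?R = 0" using serre_E21_coeff_0[OF n] serre_E21_coeff_1[OF n]
      serre_E21_coeff_2[OF n] serre_E21_coeff_3[OF n] by simp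
  ultimately show "(act (E2 * E2 * E1) h + act (E1 * E2 * E2) h) a b i
     = scl (q + inverse q) (act (E2 * E1 * E2) h) a b i" by simp
qed

lemma serre_F12: "act (F1 * F1 * F2) h + act (F2 * F1 * F1) h = scl (q + inverse q) (act (F1 * F2
    * F1) h)"
proof (intro ext)
  fix a b i
  define x y z where xyz: "x = q powi i" "y = q ^ a" "z = q ^ b"
  have n: "x \<noteq> 0" "y \<noteq> 0" "z \<noteq> 0" using q0 xyz by auto
  \<comment> \<open>Here the main splitting is on b, which F1 lowers; terms that would leave the
    grid carry \<open>cv 1 = 0\<close> or \<open>br 1 = 0\<close>.\<close>
  have r: "act (F1 * F1 * F2) h a b i + act (F2 * F1 * F1) h a b i
     - (q + inverse q) * act (F1 * F2 * F1) h a b i = ((cv z*cv (z/q)*br (y*q*q)) + (br y*cv z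
         *cv (z/q)) - (q + inverse q) * (cv z*br (y*q)*cv (z/q))) * h (a + 1) (b - 2) i
         + ((cu x y z*cv z*br (y*q) + cv z*cu x (y*q) (z/q)*br (y*q)) + (br y
         *cu x (y/q) z*cv z + br y*cv z*cu x y (z/q)) - (q + inverse q)
         * (cu x y z*br y*cv z + cv z*br (y*q)*cu x y (z/q))) * h a (b - 1) (i - 1)
         + ((cu x y z*cu (x/q) y z*br y) + (br y*cu x (y/q) z*cu (x/q) (y/q) z)
         - (q + inverse q) * (cu x y z*br y*cu (x/q) (y/q) z)) * h (a - 1) b (i - 2)"
         (is "?L = ?R")
  proof (cases b)
    case 0
    thus ?thesis using n q0
      by (cases a; simp add: act_simps op_alt powi_shift powi_shift2 xyz del: opg.simps(5-7);
      (simp add: powi_shift2 algebra_simps)?)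
  next
    case (Suc n)
    thus ?thesis
    proof (cases n)
      case 0
      thus ?thesis using Suc n q0 xyz
        by (cases a; simp add: act_simps op_alt powi_shift powi_shift2 xyz del: opg.simps(5-7);
        (simp add: powi_shift2 algebra_simps)?)
    next
      case (Suc m)
      thus ?thesis using \<open>b = Suc n\<close> n q0 xyz
        by (cases a; simp add: act_simps op_alt powi_shift powi_shift2 xyz del: opg.simps(5-7);
        (simp add: powi_shift2 algebra_simps)?)
    qed
  qed
  moreover have "?R = 0" using serre_F12_coeff_0[OF n] serre_F12_coeff_1[OF n]
      serre_F12_coeff_2[OF n] by simp
  ultimately show "(act (F1 * F1 * F2) h + act (F2 * F1 * F1) h) a b i
     = scl (q + inverse q) (act (F1 * F2 * F1) h) a b i" by simp
qed

lemma relKE11: "act (Kg1 * E1 * Kg1i) h = scl (q^2) (act E1 h)"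
proof (intro ext)
  fix a b i
  show "(act (Kg1 * E1 * Kg1i) h) a b i = (scl (q^2) (act E1 h)) a b i"
    using q0 \<kappa>0 qx[of i] qq \<alpha>0
    by (cases a; cases b; simp add: act_simps powi_shift inverse_eq_divide; (simp add: br_def ff_def)?;
        (simp add: divide_simps)?; (simp add: algebra_simps eval_nat_numeral)?)
qed

lemma relKF11: "act (Kg1 * F1 * Kg1i) h = scl (1/q^2) (act F1 h)"
proof (intro ext)
  fix a b i
  show "(act (Kg1 * F1 * Kg1i) h) a b i = (scl (1/q^2) (act F1 h)) a b i"
    using q0 \<kappa>0 qx[of i] qq \<alpha>0
    by (cases a; cases b; simp add: act_simps powi_shift inverse_eq_divide; (simp add: br_def ff_def)?;
        (simp add: divide_simps)?; (simp add: algebra_simps eval_nat_numeral)?)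
qed

lemma relKE12: "act (Kg1 * E2 * Kg1i) h = scl (1/q) (act E2 h)"
proof (intro ext)
  fix a b i
  show "(act (Kg1 * E2 * Kg1i) h) a b i = (scl (1/q) (act E2 h)) a b i"
    using q0 \<kappa>0 qx[of i] qq \<alpha>0
    by (cases a; cases b; simp add: act_simps powi_shift inverse_eq_divide; (simp add: br_def ff_def)?;
        (simp add: divide_simps)?; (simp add: algebra_simps eval_nat_numeral)?)
qed

lemma relKF12: "act (Kg1 * F2 * Kg1i) h = scl (q) (act F2 h)"
proof (intro ext)
  fix a b i
  show "(act (Kg1 * F2 * Kg1i) h) a b i = (scl (q) (act F2 h)) a b i"
    using q0 \<kappa>0 qx[of i] qq \<alpha>0
    by (cases a; cases b; simp add: act_simps powi_shift inverse_eq_divide; (simp add: br_def ff_def)?;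
        (simp add: divide_simps)?; (simp add: algebra_simps eval_nat_numeral)?)
qed

lemma relKE21: "act (Kg2 * E1 * Kg2i) h = scl (1/q) (act E1 h)"
proof (intro ext)
  fix a b i
  show "(act (Kg2 * E1 * Kg2i) h) a b i = (scl (1/q) (act E1 h)) a b i"
    using q0 \<kappa>0 qx[of i] qq \<alpha>0
    by (cases a; cases b; simp add: act_simps powi_shift inverse_eq_divide; (simp add: br_def ff_def)?;
        (simp add: divide_simps)?; (simp add: algebra_simps eval_nat_numeral)?)
qed

lemma relKF21: "act (Kg2 * F1 * Kg2i) h = scl (q) (act F1 h)"
proof (intro ext)
  fix a b i
  show "(act (Kg2 * F1 * Kg2i) h) a b i = (scl (q) (act F1 h)) a b i"
    using q0 \<kappa>0 qx[of i] qq \<alpha>0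
    by (cases a; cases b; simp add: act_simps powi_shift inverse_eq_divide; (simp add: br_def ff_def)?;
        (simp add: divide_simps)?; (simp add: algebra_simps eval_nat_numeral)?)
qed

lemma relKE22: "act (Kg2 * E2 * Kg2i) h = scl (q^2) (act E2 h)"
proof (intro ext)
  fix a b i
  show "(act (Kg2 * E2 * Kg2i) h) a b i = (scl (q^2) (act E2 h)) a b i"
    using q0 \<kappa>0 qx[of i] qq \<alpha>0
    by (cases a; cases b; simp add: act_simps powi_shift inverse_eq_divide; (simp add: br_def ff_def)?;
        (simp add: divide_simps)?; (simp add: algebra_simps eval_nat_numeral)?)
qed

lemma relKF22: "act (Kg2 * F2 * Kg2i) h = scl (1/q^2) (act F2 h)"
proof (intro ext)
  fix a b i
  show "(act (Kg2 * F2 * Kg2i) h) a b i = (scl (1/q^2) (act F2 h)) a b i"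
    using q0 \<kappa>0 qx[of i] qq \<alpha>0
    by (cases a; cases b; simp add: act_simps powi_shift inverse_eq_divide; (simp add: br_def ff_def)?;
        (simp add: divide_simps)?; (simp add: algebra_simps eval_nat_numeral)?)
qed

lemma relEF12: "act (E1 * F2) h = act (F2 * E1) h"
proof (intro ext)
  fix a b i
  show "(act (E1 * F2) h) a b i = (act (F2 * E1) h) a b i"
    using q0 \<kappa>0 qx[of i] qq \<alpha>0
    by (cases a; cases b; simp add: act_simps powi_shift inverse_eq_divide; (simp add: br_def ff_def)?;
        (simp add: divide_simps)?; (simp add: algebra_simps eval_nat_numeral)?)
qed

lemma relEF21: "act (E2 * F1) h = act (F1 * E2) h"
proof (intro ext)
  fix a b i
  show "(act (E2 * F1) h) a b i = (act (F1 * E2) h) a b i"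
    using q0 \<kappa>0 qx[of i] qq \<alpha>0
    by (cases a; cases b; simp add: act_simps powi_shift inverse_eq_divide; (simp add: br_def ff_def)?;
        (simp add: divide_simps)?; (simp add: algebra_simps eval_nat_numeral)?)
qed

lemma relEF11: "act (E1 * F1) h = act (F1 * E1) h + scl (1/(q-inverse q)) (act Kg1 h - act Kg1i h)"
proof (intro ext)
  fix a b i
  show "(act (E1 * F1) h) a b i = (act (F1 * E1) h + scl (1/(q-inverse q)) (act Kg1 h
      - act Kg1i h)) a b i"
    using q0 \<kappa>0 qx[of i] qq \<alpha>0
    by (cases a; cases b; simp add: act_simps powi_shift inverse_eq_divide; (simp add: br_def ff_def)?;
        (simp add: divide_simps)?; (simp add: algebra_simps eval_nat_numeral)?)
qed

lemma relEF22: "act (E2 * F2) h = act (F2 * E2) h + scl (1/(q-inverse q)) (act Kg2 h - act Kg2i h)"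
proof (intro ext)
  fix a b i
  show "(act (E2 * F2) h) a b i = (act (F2 * E2) h + scl (1/(q-inverse q)) (act Kg2 h
      - act Kg2i h)) a b i"
    using q0 \<kappa>0 qx[of i] qq \<alpha>0
    by (cases a; cases b; simp add: act_simps powi_shift inverse_eq_divide; (simp add: br_def ff_def)?;
        (simp add: divide_simps)?; (simp add: algebra_simps eval_nat_numeral)?)
qed

text \<open>F2 has one term and F1 has two, so only two shifted values of \<open>h\<close> occur and
  the identity can be checked without naming coefficients.\<close>

lemma serre_F21: "act (F2 * F2 * F1) h + act (F1 * F2 * F2) h = scl (q + inverse q) (act (F2 * F1
    * F2) h)"
proof (intro ext)
  fix a b i
  show "(act (F2 * F2 * F1) h + act (F1 * F2 * F2) h) a b i = (scl (q + inverse q) (act (F2 * F1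
      * F2) h)) a b i"
    using q0 \<kappa>0 qx[of i] qq \<alpha>0
    by (cases a; cases "a - 1"; cases b; simp add: act_simps powi_shift inverse_eq_divide;
        (simp add: br_def ff_def)?;
        (simp add: divide_simps)?; (simp add: algebra_simps eval_nat_numeral)?)
qed

lemma relK: "act (Kg1 * Kg1i) h = h" "act (Kg1i * Kg1) h = h" "act (Kg2 * Kg2i) h = h" "act (Kg2i
    * Kg2) h = h"
  "act (Kg1 * Kg2) h = act (Kg2 * Kg1) h"
  by (intro ext; use q0 \<kappa>0 in \<open>simp add: act_simps power2_eq_square\<close>)+

end

section \<open>The annihilator of the cyclic vector\<close>

lemma powi_cartan: "q powi 2 = q^2" "(q::complex) powi -1 = 1 / q" "q powi -2 =
    1/q^2" "q powi (- (- 1)) = q"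
  by (simp_all add: power_int_minus inverse_eq_divide)

context whittaker_params begin

lemma act_Urels:
  assumes "r \<in> Urels q"
  shows "act r h = 0"
proof -
  have eq: "act (u - v) h = 0" if "act u h = act v h" for u v
    unfolding act_diff that by (rule diff_self)
  have sc: "act (sc k * u) h = scl k (act u h)" for k u
    unfolding act_mult act_sc ..
  \<comment> \<open>A relator has its scalar attached to the first generator, whereas the operator
    identities keep the scalar in front of a product of three generators.\<close>
  have serre: "act (u - sc k * v * w * x + y) h = 0" if "act u h + act y h = scl k (act (v * w
      * x) h)" for u k v w x y
  proof -
    have "u - sc k * v * w * x + y = (u + y) - sc k * (v * w * x)" by (simp add: algebra_simps)
    thus ?thesis using that by (simp only: eq act_add sc)
  qed
  have comm: "act (u - v - sc k * (a - b)) h = 0" if "act u h = act v h + scl k (act a h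
      - act b h)" for u v k a b
    using that by (simp only: act_diff sc add_diff_cancel_left' diff_self)
  \<comment> \<open>Each set comprehension over indices in {1, 2} becomes an explicit disjunction,
    so that every relator meets its operator identity.\<close>
  have cases: "(\<exists>i. r = g i \<and> i \<in> {1, 2}) \<longleftrightarrow> r = g 1 \<or> r = g 2" for g :: "nat \<Rightarrow> fra" by auto
  have cases2: "(\<exists>i j. r = g i j \<and> i \<in> {1, 2} \<and> j \<in> {1, 2}) \<longleftrightarrow> r = g 1 1 \<or> r = g 1 2 \<or> r = g 2 1 \<or>
      r = g 2 2"
    for g :: "nat \<Rightarrow> nat \<Rightarrow> fra" by auto
  have cases3: "(\<exists>i j. r = g i j \<and> i \<in> {1, 2} \<and> j \<in> {1, 2} \<and> i \<noteq> j) \<longleftrightarrow> r = g 1 2 \<or> r = g 2 1"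
    for g :: "nat \<Rightarrow> nat \<Rightarrow> fra"
    by (metis insert_iff singletonD numeral_eq_one_iff semiring_norm(85))
  have n: "(1::nat) \<noteq> 2" "(2::nat) \<noteq> 1" by simp_all
  from assms show ?thesis
    unfolding Urels_def Un_iff mem_Collect_eq cases cases2 cases3 singleton_iff
    apply (simp only: Kg_def Kgi_def Eg_def Fg_def cartan_def n simp_thms if_True if_False diff_zero)
    apply (elim disjE; hypsubst)
    apply ((rule comm | rule serre | rule eq);
      simp only: relK act_1 powi_cartan sc relKE11 relKE12 relKE21 relKE22
       relKF11 relKF12 relKF21 relKF22 relEF11 relEF12 relEF21 relEF22 serre_E12 serre_E21 serre_F12
       serre_F21)+
    done
qed

lemma act_Uideal: "r \<in> Uideal q \<Longrightarrow> act r h = 0"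
  unfolding Uideal_def
proof (induction r arbitrary: h rule: twosided_ideal.induct)
  case (mult a x y)
  thus ?case by (simp only: act_mult act_right_0)
qed (simp_all only: act_Urels act_0 act_add add_0)

definition v0 :: cfun where "v0 = (\<lambda>a b i. if a = 0 \<and> b = 0 then 1 else 0)"

definition Ker :: "fra set" where "Ker = {u. act u v0 = 0}"

lemma v0_E1: "act E1 v0 = scl \<alpha> v0" and v0_E2: "act E2 v0 = 0"
  by (intro ext; simp add: act_simps v0_def)+

lemma v0_Kel: "act Kel v0 = scl \<kappa> v0"
  by (intro ext) (use q0 in \<open>auto simp: Kel_def act_simps v0_def power2_eq_square\<close>)

lemma v0_C1el: "act (C1el q) v0 = scl c v0"
proof (intro ext)
  fix a b i
  have d: "q - inverse q \<noteq> 0" using qq(3) by (simp add: inverse_eq_divide)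
  \<comment> \<open>The definition of \<open>ff\<close>, solved for c.\<close>
  have "c = ff (q powi i) * \<alpha> + (\<kappa> * q / (q powi i)\<^sup>2 + (q powi i)\<^sup>2 / (\<kappa> * q)) / (q - inverse q)\<^sup>2"
    using \<alpha>0 unfolding ff_def by (simp add: inverse_eq_divide)
  note c = this[symmetric]
  show "act (C1el q) v0 a b i = scl c v0 a b i"
    unfolding C1el_def using c q0 \<kappa>0 d
    by (auto simp:
        act_mult act_add act_gn act_sc v0_E1 opg_scl v0_def inverse_eq_divide diff_divide_distrib add_divide_distrib mult.commute)
qed

lemma Ker_submod: "submod regA Ker"
  by (rule submodI) (auto simp: regA_def Ker_def act_add act_mult act_0 act_right_0)

lemma Ker_memI:
  "E1 - sc \<alpha> \<in> Ker" "E2 \<in> Ker" "Kel - sc \<kappa> \<in> Ker" "C1el q - sc c \<in> Ker" "Uideal q \<subseteq> Ker" "1 \<notin> Ker"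
proof -
  show "1 \<notin> Ker"
  proof
    assume "1 \<in> Ker"
    hence "v0 0 0 0 = 0" unfolding Ker_def by (simp add: act_1)
    thus False unfolding v0_def by simp
  qed
qed (auto simp only:
    Ker_def mem_Collect_eq act_diff act_sc v0_E1 v0_E2 v0_Kel v0_C1el diff_self act_Uideal)

end

section \<open>Straightening in the free algebra\<close>

lemma submod_regA_iff:
  "submod regA J \<longleftrightarrow> 0 \<in> J \<and> (\<forall>x\<in>J. \<forall>y\<in>J. x + y \<in> J) \<and> (\<forall>r. \<forall>x\<in>J. r * x \<in> J)"
  unfolding submod_def regA_def by simp

lemma lidealD:
  assumes "submod regA J"
  shows "0 \<in> J" "\<And>x y. x \<in> J \<Longrightarrow> y \<in> J \<Longrightarrow> x + y \<in> J" "\<And>r x. x \<in> J \<Longrightarrow> r * x \<in> J"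
    "\<And>x. x \<in> J \<Longrightarrow> - x \<in> J" "\<And>x y. x \<in> J \<Longrightarrow> y \<in> J \<Longrightarrow> x - y \<in> J"
proof -
  show 1: "0 \<in> J" "\<And>x y. x \<in> J \<Longrightarrow> y \<in> J \<Longrightarrow> x + y \<in> J" "\<And>r x. x \<in> J \<Longrightarrow> r * x \<in> J"
    using assms unfolding submod_regA_iff by blast+
  show 2: "- x \<in> J" if "x \<in> J" for x using 1(3)[of x "- 1"] that by simp
  show "x - y \<in> J" if "x \<in> J" "y \<in> J" for x y using 1(2)[of x "- y"] 2 that by simp
qed

lemma Uideal_left: "r \<in> Uideal q \<Longrightarrow> x * r \<in> Uideal q"
  and Uideal_right: "r \<in> Uideal q \<Longrightarrow> r * x \<in> Uideal q"
  and Uideal_add: "r \<in> Uideal q \<Longrightarrow> r' \<in> Uideal q \<Longrightarrow> r + r' \<in> Uideal q"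
  and Uideal_uminus: "r \<in> Uideal q \<Longrightarrow> - r \<in> Uideal q"
  and Uideal_diff: "r \<in> Uideal q \<Longrightarrow> r' \<in> Uideal q \<Longrightarrow> r - r' \<in> Uideal q"
proof -
  have l: "x * r \<in> Uideal q" if "r \<in> Uideal q" for x r
    using twosided_ideal.mult[of r "Urels q" x 1] that unfolding Uideal_def by simp
  have a: "r + r' \<in> Uideal q" if "r \<in> Uideal q" "r' \<in> Uideal q" for r r'
    using that twosided_ideal.add unfolding Uideal_def by blast
  show "x * r \<in> Uideal q" if "r \<in> Uideal q" using that l by blast
  show "r + r' \<in> Uideal q" if "r \<in> Uideal q" "r' \<in> Uideal q" using that a by blast
  show "r * x \<in> Uideal q" if "r \<in> Uideal q"
    using twosided_ideal.mult[of r "Urels q" 1 x] that unfolding Uideal_def by simp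
  show "- r \<in> Uideal q" if "r \<in> Uideal q" using l[OF that, of "- 1"] by simp
  show "r - r' \<in> Uideal q" if "r \<in> Uideal q" "r' \<in> Uideal q"
    using a[of r "- r'"] l[of r' "- 1"] that by simp
qed

lemma Uideal_base: "r \<in> Urels q \<Longrightarrow> r \<in> Uideal q"
  unfolding Uideal_def by (rule twosided_ideal.base)

lemma Urels_intros:
  assumes "i \<in> {1, 2}" "j \<in> {1, 2}"
  shows "Kg i * Kgi i - 1 \<in> Urels q" "Kgi i * Kg i - 1 \<in> Urels q" "Kg1 * Kg2 - Kg2 * Kg1 \<in> Urels q"
    "Eg i * Fg j - Fg j * Eg i
        - (if i = j then sc (1 / (q - inverse q)) * (Kg i - Kgi i) else 0) \<in> Urels q"
    "Kg i * Eg j * Kgi i - sc (q powi cartan i j) * Eg j \<in> Urels q"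
    "Kg i * Fg j * Kgi i - sc (q powi (- cartan i j)) * Fg j \<in> Urels q"
    "i \<noteq> j \<Longrightarrow> Fg i * Fg i * Fg j - sc (q + inverse q) * Fg i * Fg j * Fg i + Fg j * Fg i * Fg i \<in> Urels q"
proof -
  show "Kg i * Kgi i - 1 \<in> Urels q"
    unfolding Urels_def by (rule UnI1, rule UnI1, rule UnI1, rule UnI1, rule UnI1, rule UnI1,
        rule UnI1, rule CollectI, rule exI[of _ i], intro conjI refl assms(1))
  show "Kgi i * Kg i - 1 \<in> Urels q"
    unfolding Urels_def by (rule UnI1, rule UnI1, rule UnI1, rule UnI1, rule UnI1, rule UnI1,
        rule UnI2, rule CollectI, rule exI[of _ i], intro conjI refl assms(1))
  show "Kg1 * Kg2 - Kg2 * Kg1 \<in> Urels q"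
    unfolding Urels_def by (rule UnI1, rule UnI1, rule UnI1, rule UnI1, rule UnI1, rule UnI2, simp)
  show "Eg i * Fg j - Fg j * Eg i
        - (if i = j then sc (1 / (q - inverse q)) * (Kg i - Kgi i) else 0) \<in> Urels q"
    unfolding Urels_def by (rule UnI1, rule UnI1, rule UnI1, rule UnI1, rule UnI2, rule CollectI,
        rule exI[of _ i], rule exI[of _ j], intro conjI refl assms)
  show "Kg i * Eg j * Kgi i - sc (q powi cartan i j) * Eg j \<in> Urels q"
    unfolding Urels_def by (rule UnI1, rule UnI1, rule UnI1, rule UnI2, rule CollectI,
        rule exI[of _ i], rule exI[of _ j], intro conjI refl assms)
  show "Kg i * Fg j * Kgi i - sc (q powi (- cartan i j)) * Fg j \<in> Urels q"
    unfolding Urels_def by (rule UnI1, rule UnI1, rule UnI2, rule CollectI, rule exI[of _ i],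
        rule exI[of _ j], intro conjI refl assms)
  show "Fg i * Fg i * Fg j - sc (q + inverse q) * Fg i * Fg j * Fg i + Fg j * Fg i * Fg i \<in> Urels q"
      if "i \<noteq> j"
    unfolding Urels_def by (rule UnI2, rule CollectI, rule exI[of _ i], rule exI[of _ j],
        intro conjI refl assms that)
qed

lemmas Uideal_intros = Urels_intros[THEN Uideal_base]

lemma Uideal_K: "Kg1 * Kg1i - 1 \<in> Uideal q" "Kg2 * Kg2i - 1 \<in> Uideal q"
  "Kg1i * Kg1 - 1 \<in> Uideal q" "Kg2i * Kg2 - 1 \<in> Uideal q" "Kg1 * Kg2 - Kg2 * Kg1 \<in> Uideal q"
  using Uideal_intros(1-3)[of 1 1] Uideal_intros(1,2)[of 2 2] unfolding Kg_def Kgi_def by simp_all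

lemma Uideal_EF:
  "E1 * F1 - F1 * E1 - sc (1 / (q - inverse q)) * (Kg1 - Kg1i) \<in> Uideal q"
  "E2 * F2 - F2 * E2 - sc (1 / (q - inverse q)) * (Kg2 - Kg2i) \<in> Uideal q"
  "E1 * F2 - F2 * E1 \<in> Uideal q" "E2 * F1 - F1 * E2 \<in> Uideal q"
  using Uideal_intros(4)[of 1 1] Uideal_intros(4)[of 2 2] Uideal_intros(4)[of 1 2] Uideal_intros(4)[of 2 1]
  unfolding Eg_def Fg_def Kg_def Kgi_def by simp_all

lemma Uideal_FFF:
  "F1 * F1 * F2 - sc (q + inverse q) * F1 * F2 * F1 + F2 * F1 * F1 \<in> Uideal q"
  "F2 * F2 * F1 - sc (q + inverse q) * F2 * F1 * F2 + F1 * F2 * F2 \<in> Uideal q"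
  using Uideal_intros(7)[of 1 2] Uideal_intros(7)[of 2 1] unfolding Fg_def by simp_all

text \<open>Commutation up to a scalar modulo the relations; the scalar is hidden behind an
  existential because linear spans absorb it.\<close>

definition skew :: "complex \<Rightarrow> fra \<Rightarrow> fra \<Rightarrow> bool" where
  "skew q x g \<longleftrightarrow> (\<exists>s. x * g - sc s * (g * x) \<in> Uideal q)"

lemma sc_left: "u * (sc k * v) = sc k * (u * v)"
  by (metis mult.assoc sc_commute)

lemma sc_cancel: "k \<noteq> 0 \<Longrightarrow> sc (inverse k) * (sc k * u) = u"
  by (metis left_inverse mult.assoc mult_1 sc_simps(2,4))

lemma skewI: "x * g - sc s * (g * x) \<in> Uideal q \<Longrightarrow> skew q x g"
  unfolding skew_def by blast

lemma skew_sym_aux: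
  assumes "x * g - sc s * (g * x) \<in> Uideal q" "s \<noteq> 0"
  shows "g * x - sc (inverse s) * (x * g) \<in> Uideal q"
proof -
  have "g * x - sc (inverse s) * (x * g) = - (sc (inverse s) * (x * g - sc s * (g * x)))"
    using assms(2) by (simp add: algebra_simps sc_cancel)
  thus ?thesis using assms(1) by (simp only: Uideal_left Uideal_uminus)
qed

lemma skew_conj:
  assumes "k * ki - 1 \<in> Uideal q" "ki * k - 1 \<in> Uideal q" "k * x * ki - sc s * x \<in> Uideal q" "s \<noteq> 0"
  shows "k * x - sc s * (x * k) \<in> Uideal q" "ki * x - sc (inverse s) * (x * ki) \<in> Uideal q"
    "skew q x k" "skew q x ki"
proof -
  have "k * x - sc s * (x * k) = (k * x * ki - sc s * x) * k - k * x * (ki * k - 1)"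
    by (simp add: algebra_simps)
  also have "\<dots> \<in> Uideal q" by (intro Uideal_diff Uideal_left Uideal_right assms)
  finally show 1: "k * x - sc s * (x * k) \<in> Uideal q" .
  have "x * ki - sc s * (ki * x) = ki * (k * x * ki - sc s * x) - (ki * k - 1) * (x * ki)"
    by (simp add: algebra_simps sc_left[of ki])
  also have "\<dots> \<in> Uideal q" by (intro Uideal_diff Uideal_left Uideal_right assms)
  finally have 2: "x * ki - sc s * (ki * x) \<in> Uideal q" .
  show "ki * x - sc (inverse s) * (x * ki) \<in> Uideal q" "skew q x k" "skew q x ki"
    using skew_sym_aux[OF 1 assms(4)] skew_sym_aux[OF 2 assms(4)] skewI 2 by blast+
qed

context whittaker_params begin

lemma KXs:
  assumes "i \<in> {1, 2}" "j \<in> {1, 2}"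
  shows "skew q (Eg j) (Kg i)" "skew q (Eg j) (Kgi i)" "skew q (Fg j) (Kg i)" "skew q (Fg j) (Kgi i)"
    "skew q (Kg i) (Fg j)" "skew q (Kgi i) (Fg j)"
proof -
  note k = Uideal_intros(5,6,1,2)[OF assms]
  have n: "q powi m \<noteq> 0" for m using q0 by simp
  show "skew q (Eg j) (Kg i)" "skew q (Eg j) (Kgi i)" "skew q (Fg j) (Kg i)" "skew q (Fg j) (Kgi i)"
    "skew q (Kg i) (Fg j)" "skew q (Kgi i) (Fg j)"
    using skew_conj[OF k(3,4,1) n] skew_conj[OF k(3,4,2) n] skewI by blast+
qed

abbreviation "KK \<equiv> {Kg1, Kg1i, Kg2, Kg2i}"

lemma skew_K:
  assumes "k \<in> KK"
  shows "skew q E1 k" "skew q E2 k" "skew q F1 k" "skew q F2 k" "skew q k F1" "skew q k F2"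
proof -
  have "skew q E1 k \<and> skew q E2 k \<and> skew q F1 k \<and> skew q F2 k \<and> skew q k F1 \<and> skew q k F2"
    if i: "i \<in> {1, 2}" and k: "k = Kg i \<or> k = Kgi i" for i
    using KXs[OF i, of 1] KXs[OF i, of 2] k unfolding Eg_def Fg_def by auto
  from this[of 1] this[of 2] assms
  show "skew q E1 k" "skew q E2 k" "skew q F1 k" "skew q F2 k" "skew q k F1" "skew q k F2"
    unfolding Kg_def Kgi_def by auto
qed

end

lemma commute_inverse:
  assumes "x * y - 1 \<in> Uideal q" "y * x - 1 \<in> Uideal q" "x * k - k * x \<in> Uideal q"
  shows "y * k - k * y \<in> Uideal q" "k * y - y * k \<in> Uideal q"
proof -
  have "y * k - k * y = (y * x - 1) * (k * y) - y * k * (x * y - 1) - y * (x * k - k * x) * y"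
    by (simp add: algebra_simps)
  also have "\<dots> \<in> Uideal q" by (intro Uideal_diff Uideal_left Uideal_right assms)
  finally show 1: "y * k - k * y \<in> Uideal q" .
  thus "k * y - y * k \<in> Uideal q" using Uideal_uminus[OF 1] by simp
qed

lemma skew_KK:
  assumes "k \<in> {Kg1, Kg1i}" "k' \<in> {Kg2, Kg2i}"
  shows "skew q k k'"
proof -
  note K = Uideal_K[of q]
  note 1 = commute_inverse[OF K(1,3,5)]
  have 2: "Kg2 * Kg1 - Kg1 * Kg2 \<in> Uideal q" using Uideal_uminus[OF K(5)] by simp
  note 3 = commute_inverse[OF K(2,4) 2] commute_inverse[OF K(2,4) 1(2)]
  have "k * k' - k' * k \<in> Uideal q" using assms K(5) 1 3 by auto
  thus ?thesis using skewI[of k k' 1 q] by (simp add: sc_simps)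
qed

text \<open>Closure under the F's and K's alone. In the spirit of the triangular decomposition, this
  is already a left ideal once \<open>J\<close> is a left ideal containing the relations and the E's
  send \<open>w\<close> back into the closure. Since no rule applies an E, properties preserved only
  by the F's and K's can be proved by induction over it.\<close>

inductive_set FKcl :: "fra set \<Rightarrow> fra \<Rightarrow> fra set" for J w where
  base: "u \<in> J \<Longrightarrow> u \<in> FKcl J w"
| gen: "w \<in> FKcl J w"
| add: "u \<in> FKcl J w \<Longrightarrow> v \<in> FKcl J w \<Longrightarrow> u + v \<in> FKcl J w"
| scale: "u \<in> FKcl J w \<Longrightarrow> sc k * u \<in> FKcl J w"
| mult: "u \<in> FKcl J w \<Longrightarrow> g \<in> {GF1, GF2, GK1, GK1i, GK2, GK2i} \<Longrightarrow> gn g * u \<in> FKcl J w"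

context whittaker_params begin

text \<open>An E passes a K at the cost of a scalar, and passes an F at the cost of a multiple of a
  difference of two K's; both kinds of error stay in the closure.\<close>

lemma FKcl_E:
  assumes U: "Uideal q \<subseteq> J" and J: "submod regA J" and E: "E \<in> {E1, E2}" and w: "E * w \<in> FKcl J w"
    and u: "u \<in> FKcl J w"
  shows "E * u \<in> FKcl J w"
  using u
proof induction
  case (base u)
  thus ?case using lidealD(3)[OF J] FKcl.base by blast
next
  case (add u v)
  thus ?case by (simp add: ring_distribs FKcl.add)
next
  case (scale u k)
  thus ?case by (simp add: sc_left[of E] FKcl.scale)
next
  case (mult u g)
  have r: "r * u \<in> FKcl J w" if "r \<in> Uideal q" for r
    using that U Uideal_right FKcl.base by blast
  have uminus: "- x \<in> FKcl J w" if "x \<in> FKcl J w" for x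
    using FKcl.scale[OF that, of "-1"] by (simp add: sc_simps)
  show ?case
  proof (cases "g \<in> {GK1, GK1i, GK2, GK2i}")
    case True
    hence "skew q E (gn g)" using skew_K E by auto
    then obtain s where s: "E * gn g - sc s * (gn g * E) \<in> Uideal q" unfolding skew_def by blast
    have "E * (gn g * u) = (E * gn g - sc s * (gn g * E)) * u + sc s * (gn g * (E * u))"
      by (simp add: algebra_simps)
    also have "\<dots> \<in> FKcl J w" using r[OF s] mult by (intro FKcl.add FKcl.scale FKcl.mult)
    finally show ?thesis .
  next
    case False
    \<comment> \<open>E1 commutes with F2 and E2 with F1; taking d = 0 gives them the same form as
      the two nontrivial commutators.\<close>
    have "\<exists>k k' d. k \<in> KK \<and> k' \<in> KK \<and> E * gn g - gn g * E - sc d * (k - k') \<in> Uideal q"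
    proof -
      have 0: "x - sc 0 * (Kg1 - Kg1i) = x" for x by (simp add: sc_simps)
      from E False mult(2) consider "E = E1" "g = GF1" | "E = E1" "g = GF2" | "E = E2" "g =
      GF1" | "E = E2" "g = GF2"
        by auto
      thus ?thesis
      proof cases
        case 1
        show ?thesis using Uideal_EF(1)[of q] unfolding 1 by blast
      next
        case 2
        have "E1 * F2 - F2 * E1 - sc 0 * (Kg1 - Kg1i) \<in> Uideal q" unfolding 0 by (rule Uideal_EF)
        thus ?thesis unfolding 2 by blast
      next
        case 3
        have "E2 * F1 - F1 * E2 - sc 0 * (Kg1 - Kg1i) \<in> Uideal q" unfolding 0 by (rule Uideal_EF)
        thus ?thesis unfolding 3 by blast
      next
        case 4
        show ?thesis using Uideal_EF(2)[of q] unfolding 4 by blast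
      qed
    qed
    then obtain k k' d where k: "k \<in> KK" "k' \<in> KK" and s: "E * gn g - gn g * E - sc d * (k
        - k') \<in> Uideal q"
      by blast
    have ku: "k * u \<in> FKcl J w" "k' * u \<in> FKcl J w" using k mult(1) FKcl.mult by auto
    have "E * (gn g * u) = (E * gn g - gn g * E - sc d * (k - k')) * u + gn g * (E * u) + sc d * (k
        * u + - (k' * u))"
      by (simp add: algebra_simps)
    also have "\<dots> \<in> FKcl J w" using r[OF s] mult ku by (intro FKcl.add FKcl.scale FKcl.mult uminus)
    finally show ?thesis .
  qed
qed (fact w)

lemma FKcl_submod:
  assumes U: "Uideal q \<subseteq> J" and J: "submod regA J" and w: "E1 * w \<in> FKcl J w" "E2 * w \<in> FKcl J w"
  shows "submod regA (FKcl J w)"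
  unfolding submod_regA_iff
proof (intro conjI ballI allI)
  show "0 \<in> FKcl J w" using lidealD(1)[OF J] by (rule FKcl.base)
  fix r x assume x: "x \<in> FKcl J w"
  show "x + y \<in> FKcl J w" if "y \<in> FKcl J w" for y using x that by (rule FKcl.add)
  have E: "E1 * y \<in> FKcl J w" "E2 * y \<in> FKcl J w" if "y \<in> FKcl J w" for y
    using FKcl_E[OF U J _ _ that] w by auto
  have g: "gn g * y \<in> FKcl J w" if "y \<in> FKcl J w" for g y
    using E[OF that] FKcl.mult[OF that, of g] by (cases g) auto
  show "r * x \<in> FKcl J w"
    by (induction r rule: fra_left_induct)
      (use x g FKcl.add FKcl.scale in \<open>auto simp: ring_distribs mult.assoc\<close>)
qed

end

section \<open>The spanning family modulo the left ideal\<close>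

interpretation fra: vector_space "\<lambda>k u. sc k * (u :: fra)"
  by unfold_locales (simp_all add: algebra_simps sc_simps)

definition Kpow :: "int \<Rightarrow> fra" where
  "Kpow j = (if 0 \<le> j then Kg2 ^ nat j else Kg2i ^ nat (- j))"

definition F3 :: "complex \<Rightarrow> fra" where "F3 q = F2 * F1 - sc q * (F1 * F2)"

definition pbw :: "complex \<Rightarrow> nat \<times> nat \<times> int \<Rightarrow> fra" where
  "pbw q = (\<lambda>(a, b, j). F2 ^ a * (F3 q ^ b * Kpow j))"

lemma span_left_mult:
  assumes "\<And>a. a \<in> A \<Longrightarrow> x * a \<in> fra.span B" "u \<in> fra.span A"
  shows "x * u \<in> fra.span B"
  using assms(2)
  by (induction rule: fra.span_induct_alt)
    (use assms(1) fra.span_zero fra.span_add fra.span_scale in \<open>auto simp: ring_distribs sc_left[of x]\<close>)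

text \<open>\<open>x\<close> moves through the power one factor at a time; the relator left at each
  step lies in the span, and the span is stable under \<open>g\<close>.\<close>

lemma skew_power:
  assumes "skew q x g" "Uideal q \<subseteq> fra.span B" "\<And>u. u \<in> fra.span B \<Longrightarrow> g * u \<in> fra.span B"
    "x * m \<in> fra.span B"
  shows "x * (g ^ n * m) \<in> fra.span B"
proof (induction n)
  case 0
  show ?case using assms by simp
next
  case (Suc n)
  obtain s where s: "x * g - sc s * (g * x) \<in> Uideal q" using assms(1) unfolding skew_def by blast
  have "x * (g ^ Suc n * m) = (x * g - sc s * (g * x)) * (g ^ n * m) + sc s * (g * (x * (g ^ n * m)))"
    by (simp add: algebra_simps)
  also have "\<dots> \<in> fra.span B"
    using Suc assms(2,3) Uideal_right[OF s] by (intro fra.span_add fra.span_scale) auto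
  finally show ?case .
qed

text \<open>Positive and negative powers use different letters of the free algebra, so a step
  towards exponent zero is correct only up to a relator.\<close>

lemma Uideal_Kpow: "Kg2 * Kpow j - Kpow (j + 1) \<in> Uideal q" "Kg2i * Kpow j - Kpow (j - 1) \<in> Uideal q"
proof -
  have zero: "0 \<in> Uideal q" unfolding Uideal_def by (rule twosided_ideal.zero)
  have s: "nat (j + 1) = Suc (nat j)" if "0 \<le> j" using that by simp
  have s': "nat (- j) = Suc (nat (- j - 1))" if "j < 0" using that by simp
  have t: "nat j = Suc (nat (j - 1))" if "0 < j" using that by simp
  have t': "nat (1 - j) = Suc (nat (- j))" if "j \<le> 0" using that by simp
  have "Kg2 * (Kg2i * x) - x \<in> Uideal q" "Kg2i * (Kg2 * x) - x \<in> Uideal q" for x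
    using Uideal_right[OF Uideal_K(2), where x = x] Uideal_right[OF Uideal_K(4), where x = x]
    by (simp_all add: algebra_simps)
  note this [simp] zero [simp] Uideal_K(2)[of q, simp]
  show "Kg2 * Kpow j - Kpow (j + 1) \<in> Uideal q"
    using s s' unfolding Kpow_def by (cases "j < 0"; cases "j = -1") auto
  show "Kg2i * Kpow j - Kpow (j - 1) \<in> Uideal q"
    using t t' unfolding Kpow_def by (cases "0 < j"; cases "j = 0") auto
qed

locale whittaker_ideal = whittaker_params +
  fixes I :: "fra set"
  assumes I: "submod regA I" and UI: "Uideal q \<subseteq> I"
    and mem: "E1 - sc \<alpha> \<in> I" "E2 \<in> I" "Kel - sc \<kappa> \<in> I" "C1el q - sc c \<in> I"
begin

lemma I_mult: "x \<in> I \<Longrightarrow> r * x \<in> I"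
  using lidealD(3)[OF I] .

text \<open>K acts by \<kappa>, so K1 = K2^(-2) K acts through K2.\<close>

lemma I_Kg1: "Kg1 - sc \<kappa> * (Kg2i * Kg2i) \<in> I"
proof -
  let ?m = "Kg1 * Kg2 - Kg2 * Kg1" and ?e = "Kg2i * Kg2 - 1"
  \<comment> \<open>This combination of relators telescopes to K2^(-2) K1 K2^2 - K1: it moves K1
    past both factors K2 and cancels them.\<close>
  have "Kg2i * Kg2i * ?m * Kg2 + Kg2i * ?e * (Kg1 * Kg2) + Kg2i * ?m + ?e * Kg1 \<in> Uideal q"
    by (intro Uideal_add Uideal_left Uideal_right Uideal_K)
  moreover have "Kg2i * Kg2i * ?m * Kg2 + Kg2i * ?e * (Kg1 * Kg2) + Kg2i * ?m + ?e * Kg1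
      = Kg2i * Kg2i * Kel - Kg1"
    unfolding Kel_def by (simp add: algebra_simps)
  ultimately have "Kg2i * Kg2i * Kel - Kg1 \<in> I" using UI by auto
  moreover have "Kg1 - sc \<kappa> * (Kg2i * Kg2i) = Kg2i * Kg2i * (Kel - sc \<kappa>) - (Kg2i * Kg2i * Kel - Kg1)"
    by (simp add: algebra_simps sc_commute[symmetric, of Kg2i] sc_left[of Kg2i])
  ultimately show ?thesis using lidealD(5)[OF I] I_mult[OF mem(3)] by metis
qed

lemma I_Kg1i: "Kg1i - sc (inverse \<kappa>) * (Kg2 * Kg2) \<in> I"
proof -
  have "(Kg1i * Kg1 - 1) * (Kg2 * Kg2) \<in> I" using UI Uideal_right[OF Uideal_K(3)] by blast
  hence "sc (inverse \<kappa>) * ((Kg1i * Kg1 - 1) * (Kg2 * Kg2) - Kg1i * (Kel - sc \<kappa>)) \<in> I"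
    by (intro I_mult[of "_ - _"] lidealD(5)[OF I] I_mult[OF mem(3)])
  also have "sc (inverse \<kappa>) * ((Kg1i * Kg1 - 1) * (Kg2 * Kg2) - Kg1i * (Kel - sc \<kappa>))
      = Kg1i - sc (inverse \<kappa>) * (Kg2 * Kg2)"
    unfolding Kel_def
    using sc_cancel[OF \<kappa>0, of Kg1i] by (simp add: algebra_simps sc_commute[symmetric, of Kg1i])
  finally show ?thesis .
qed

text \<open>Modulo \<open>I\<close> the generator E1 is the nonzero scalar \<alpha>, so
  \<open>C1 - c\<close> can be solved for F1.\<close>

lemma I_F1: "F1 - sc (inverse \<alpha>) * (sc c - sc (1 / (q - inverse q)^2) * (sc q * Kg1 + sc (inverse q)
    * Kg1i)) \<in> I"
proof -
  have "sc (inverse \<alpha>) * ((C1el q - sc c) - F1 * (E1 - sc \<alpha>)) \<in> I"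
    by (intro I_mult[of "_ - _"] lidealD(5)[OF I] I_mult[OF mem(1)] mem(4))
  also have "sc (inverse \<alpha>) * ((C1el q - sc c) - F1 * (E1 - sc \<alpha>))
      = F1 - sc (inverse \<alpha>) * (sc c - sc (1 / (q - inverse q)^2) * (sc q * Kg1 + sc (inverse q) * Kg1i))"
    unfolding C1el_def
    using sc_cancel[OF \<alpha>0, of F1] by (simp add: algebra_simps sc_commute[symmetric, of F1])
  finally show ?thesis .
qed

text \<open>Both expressions expand to -q times a Serre relator; this is why F3 is the q-commutator
  of F2 and F1.\<close>

lemma skew_F3: "skew q F1 (F3 q)" "skew q (F3 q) F2"
proof -
  have "F1 * F3 q - sc q * (F3 q * F1) = - (sc q * (F1 * F1 * F2 - sc (q + inverse q) * F1 * F2 * F1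
      + F2 * F1 * F1))"
    unfolding F3_def by (simp add:
        algebra_simps sc_simps(3) sc_left[of F1] sc_left[of F2] sc_simps(2) q0)
  also have "\<dots> \<in> Uideal q" by (intro Uideal_uminus Uideal_left Uideal_FFF)
  finally show "skew q F1 (F3 q)" by (rule skewI)
  have "F3 q * F2 - sc q * (F2 * F3 q) = - (sc q * (F2 * F2 * F1 - sc (q + inverse q) * F2 * F1 * F2
      + F1 * F2 * F2))"
    unfolding F3_def by (simp add:
        algebra_simps sc_simps(3) sc_left[of F1] sc_left[of F2] sc_simps(2) q0)
  also have "\<dots> \<in> Uideal q" by (intro Uideal_uminus Uideal_left Uideal_FFF)
  finally show "skew q (F3 q) F2" by (rule skewI)
qed

lemma skew_K_F3: "k \<in> KK \<Longrightarrow> skew q k (F3 q)"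
proof -
  assume "k \<in> KK"
  note k = skew_K(5,6)[OF this]
  obtain s where s: "k * F1 - sc s * (F1 * k) \<in> Uideal q" using k(1) unfolding skew_def by blast
  obtain t where t: "k * F2 - sc t * (F2 * k) \<in> Uideal q" using k(2) unfolding skew_def by blast
  have "k * F3 q - sc (s * t) * (F3 q * k) =
    (k * F2 - sc t * (F2 * k)) * F1 + sc t * (F2 * (k * F1 - sc s * (F1 * k)))
    - sc q * ((k * F1 - sc s * (F1 * k)) * F2 + sc s * (F1 * (k * F2 - sc t * (F2 * k))))"
    unfolding F3_def by (simp add: algebra_simps sc_left[of k] sc_left[of F1] sc_left[of F2])
  also have "\<dots> \<in> Uideal q"
    by (intro Uideal_diff Uideal_add Uideal_left Uideal_right s t)
  finally show ?thesis by (rule skewI)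
qed

text \<open>Three layers over \<open>I\<close>, built from the right. Modulo \<open>I\<close>, K1
  and F1 reduce to Laurent polynomials in K2, so T0 is stable under the K's and F1; T1 is stable
  under F3 as well, and T2 also under F2.\<close>

definition "T0 = fra.span (range Kpow \<union> I)"
definition "T1 = fra.span ({F3 q ^ b * Kpow j | b j. True} \<union> I)"
definition "T2 = fra.span (range (pbw q) \<union> I)"

lemma close_mod: "u - v \<in> I \<Longrightarrow> v \<in> fra.span (B \<union> I) \<Longrightarrow> u \<in> fra.span (B \<union> I)"
  by (metis Un_iff diff_add_cancel fra.span_add fra.span_base)

lemma I_span: "I \<subseteq> fra.span (B \<union> I)" "Uideal q \<subseteq> fra.span (B \<union> I)"
  using UI fra.span_superset by blast+

lemma T0_K2: "k \<in> {Kg2, Kg2i} \<Longrightarrow> u \<in> T0 \<Longrightarrow> k * u \<in> T0"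
  unfolding T0_def
proof (erule span_left_mult[rotated])
  fix a assume k: "k \<in> {Kg2, Kg2i}" and a: "a \<in> range Kpow \<union> I"
  have K: "Kpow j \<in> fra.span (range Kpow \<union> I)" for j by (simp add: fra.span_base)
  show "k * a \<in> fra.span (range Kpow \<union> I)"
    using a unfolding Un_iff
  proof (elim disjE)
    assume "a \<in> I"
    thus ?thesis using I_mult I_span(1) by blast
  next
    assume "a \<in> range Kpow"
    then obtain j where j: "a = Kpow j" by blast
    have "k * Kpow j - Kpow (j + 1) \<in> I \<or> k * Kpow j - Kpow (j - 1) \<in> I"
        using k UI Uideal_Kpow[of _ q] by blast
    thus ?thesis unfolding j using close_mod K by blast
  qed
qed

lemma Kpow_0: "Kpow 0 = 1"
  unfolding Kpow_def by simp

lemma T0_1: "1 \<in> T0"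
  unfolding T0_def using Kpow_0 fra.span_base by (metis UnI1 rangeI)

lemma T0_skew:
  assumes "skew q x Kg2" "skew q x Kg2i" "x \<in> T0" "u \<in> T0"
  shows "x * u \<in> T0"
  using assms(4) unfolding T0_def
proof (rule span_left_mult[rotated])
  fix a assume a: "a \<in> range Kpow \<union> I"
  have "x * (k ^ n * 1) \<in> T0" if "k \<in> {Kg2, Kg2i}" for k n
    unfolding T0_def by (rule skew_power[where q = q])
     (use assms that I_span T0_K2[OF that] in \<open>auto simp: T0_def\<close>)
  hence "x * Kpow j \<in> T0" for j unfolding Kpow_def by auto
  thus "x * a \<in> fra.span (range Kpow \<union> I)" using a I_mult I_span unfolding T0_def by blast
qed

lemma T0_K: "k \<in> KK \<Longrightarrow> u \<in> T0 \<Longrightarrow> k * u \<in> T0"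
proof -
  have *: "x \<in> T0" if "x - y \<in> I" "y \<in> T0" for x y using that close_mod unfolding T0_def by blast
  have "Kg2i * (Kg2i * 1) \<in> T0" "Kg2 * (Kg2 * 1) \<in> T0" using T0_K2 T0_1 by blast+
  hence "sc k * (Kg2i * Kg2i) \<in> T0" "sc k * (Kg2 * Kg2) \<in> T0" for k
    using fra.span_scale unfolding T0_def by simp_all
  hence "Kg1 \<in> T0" "Kg1i \<in> T0" using * I_Kg1 I_Kg1i by blast+
  moreover assume "k \<in> KK" "u \<in> T0"
  ultimately show ?thesis using T0_K2 T0_skew skew_KK by auto
qed

lemma T0_F1: "u \<in> T0 \<Longrightarrow> F1 * u \<in> T0"
proof -
  have *: "x \<in> T0" if "x - y \<in> I" "y \<in> T0" for x y using that close_mod unfolding T0_def by blast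
  have k: "Kg1 * 1 \<in> T0" "Kg1i * 1 \<in> T0" using T0_K T0_1 by blast+
  have "sc (inverse \<alpha>) * (sc c * 1 - sc (1 / (q - inverse q)^2) * (sc q * (Kg1 * 1) + sc (inverse q)
      * (Kg1i * 1))) \<in> T0"
    using k T0_1 unfolding T0_def by (intro fra.span_scale fra.span_diff fra.span_add)
  hence "F1 \<in> T0" using * I_F1 by simp
  moreover assume "u \<in> T0"
  ultimately show ?thesis using T0_skew skew_K by simp
qed

lemma T1_F3: "u \<in> T1 \<Longrightarrow> F3 q * u \<in> T1"
  unfolding T1_def
proof (erule span_left_mult[rotated])
  fix a assume a: "a \<in> {F3 q ^ b * Kpow j | b j. True} \<union> I"
  have "F3 q * (F3 q ^ b * Kpow j) \<in> fra.span ({F3 q ^ b * Kpow j | b j. True} \<union> I)" for b j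
    by (rule fra.span_base) (auto simp flip: power_Suc mult.assoc)
  thus "F3 q * a \<in> fra.span ({F3 q ^ b * Kpow j | b j. True} \<union> I)" using a I_mult I_span by blast
qed

lemma T1_skew:
  assumes "skew q x (F3 q)" "\<And>u. u \<in> T0 \<Longrightarrow> x * u \<in> T0" "u \<in> T1"
  shows "x * u \<in> T1"
  using assms(3) unfolding T1_def
proof (rule span_left_mult[rotated])
  fix a assume a: "a \<in> {F3 q ^ b * Kpow j | b j. True} \<union> I"
  have "range Kpow \<subseteq> {F3 q ^ b * Kpow j | b j. True}" by (force intro: exI[of _ 0])
  hence "T0 \<subseteq> T1" unfolding T0_def T1_def by (intro fra.span_mono) blast
  moreover have "Kpow j \<in> T0" for j unfolding T0_def by (simp add: fra.span_base)
  ultimately have "x * Kpow j \<in> T1" for j using assms(2) by blast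
  hence "x * (F3 q ^ b * Kpow j) \<in> T1" for b j
    unfolding T1_def by (intro skew_power[OF assms(1)]) (use I_span T1_F3 in \<open>auto simp: T1_def\<close>)
  thus "x * a \<in> fra.span ({F3 q ^ b * Kpow j | b j. True} \<union> I)" using a I_mult I_span
      unfolding T1_def by blast
qed

lemma pbw_simps: "pbw q (a, b, j) = F2 ^ a * (F3 q ^ b * Kpow j)"
  unfolding pbw_def by simp

lemma T2_F2: "u \<in> T2 \<Longrightarrow> F2 * u \<in> T2"
  unfolding T2_def
proof (erule span_left_mult[rotated])
  fix a assume a: "a \<in> range (pbw q) \<union> I"
  have "F2 * pbw q (a, b, j) = pbw q (Suc a, b, j)" for a b j by (simp add: pbw_simps mult.assoc)
  hence "F2 * pbw q s \<in> fra.span (range (pbw q) \<union> I)" for s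
    by (cases s) (simp add: fra.span_base)
  thus "F2 * a \<in> fra.span (range (pbw q) \<union> I)" using a I_mult I_span by blast
qed

lemma T1_T2: "T1 \<subseteq> T2"
  unfolding T1_def T2_def by (intro fra.span_mono) (force simp: image_iff pbw_def intro: exI[of _ 0])

lemma T1_base: "F3 q ^ b * Kpow j \<in> T1"
  unfolding T1_def by (rule fra.span_base) blast

lemma T2_skew:
  assumes "skew q x F2" "\<And>u. u \<in> T1 \<Longrightarrow> x * u \<in> T1" "u \<in> T2"
  shows "x * u \<in> T2"
  using assms(3) unfolding T2_def
proof (rule span_left_mult[rotated])
  fix a assume a: "a \<in> range (pbw q) \<union> I"
  have "x * (F3 q ^ b * Kpow j) \<in> T2" for b j using assms(2)[OF T1_base] T1_T2 by blast
  hence "x * pbw q (a, b, j) \<in> T2" for a b j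
    unfolding T2_def pbw_simps by (intro skew_power[OF assms(1)]) (use I_span T2_F2 in \<open>auto simp:
        T2_def\<close>)
  hence "x * pbw q s \<in> T2" for s by (cases s) simp
  thus "x * a \<in> fra.span (range (pbw q) \<union> I)" using a I_mult I_span unfolding T2_def by blast
qed

lemma T2_K: "k \<in> KK \<Longrightarrow> u \<in> T2 \<Longrightarrow> k * u \<in> T2"
  by (rule T2_skew[OF _ T1_skew[OF _ T0_K]]) (auto intro: skew_K skew_K_F3)

lemma T2_F3: "u \<in> T2 \<Longrightarrow> F3 q * u \<in> T2"
  by (rule T2_skew[OF skew_F3(2) T1_F3])

text \<open>Here \<open>T2_skew\<close> has no commutation with F2 to work with; instead F1 F2 =
  q^(-1) (F2 F1 - F3) is applied to one factor F2 at a time, which needs stability under F3.\<close>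

lemma T2_F1: "u \<in> T2 \<Longrightarrow> F1 * u \<in> T2"
  unfolding T2_def
proof (erule span_left_mult[rotated])
  fix a assume a: "a \<in> range (pbw q) \<union> I"
  have "F1 * (F2 ^ n * (F3 q ^ b * Kpow j)) \<in> T2" for n b j
  proof (induction n)
    case 0
    show ?case using T1_skew[OF skew_F3(1) T0_F1 T1_base] T1_T2 by auto
  next
    case (Suc n)
    let ?t = "F2 ^ n * (F3 q ^ b * Kpow j)"
    have t: "?t \<in> T2" unfolding T2_def pbw_simps[symmetric] by (simp add: fra.span_base)
    have "F1 * (F2 ^ Suc n * (F3 q ^ b * Kpow j)) = sc (inverse q) * (F2 * (F1 * ?t) - F3 q * ?t)"
      unfolding F3_def using sc_cancel[OF q0] by (simp add: algebra_simps)
    also have "\<dots> \<in> T2" using T2_F2[OF Suc] T2_F3[OF t] unfolding T2_def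
        by (intro fra.span_scale fra.span_diff)
    finally show ?case .
  qed
  hence "F1 * pbw q s \<in> T2" for s by (cases s) (simp add: pbw_simps)
  thus "F1 * a \<in> fra.span (range (pbw q) \<union> I)" using a I_mult I_span unfolding T2_def by blast
qed

text \<open>The E's act on 1 by scalars modulo \<open>I\<close>, so \<open>FKcl I 1\<close> is the
  whole algebra, and it suffices that T2 is stable under the F's and K's.\<close>

lemma pbw_span: "fra.span (range (pbw q) \<union> I) = UNIV"
proof -
  have "submod regA (FKcl I 1)"
  proof (rule FKcl_submod[OF UI I])
    have "E1 * 1 = (E1 - sc \<alpha>) + sc \<alpha> * 1" by simp
    also have "\<dots> \<in> FKcl I 1" using mem by (intro FKcl.add FKcl.base FKcl.scale FKcl.gen)
    finally show "E1 * 1 \<in> FKcl I 1" .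
    show "E2 * 1 \<in> FKcl I 1" using mem FKcl.base by simp
  qed
  hence "u * 1 \<in> FKcl I 1" for u using lidealD(3) FKcl.gen by blast
  moreover have "FKcl I 1 \<subseteq> T2"
  proof
    fix u assume "u \<in> FKcl I 1"
    thus "u \<in> T2"
    proof induction
      case (base u)
      thus ?case unfolding T2_def using I_span by blast
    next
      case gen
      have "1 = pbw q (0, 0, 0)" by (simp add: pbw_simps Kpow_0)
      thus ?case unfolding T2_def by (simp add: fra.span_base)
    next
      case (add u v)
      thus ?case unfolding T2_def by (intro fra.span_add)
    next
      case (scale u k)
      thus ?case unfolding T2_def by (intro fra.span_scale)
    next
      case (mult u g)
      thus ?case using T2_F1 T2_F2 T2_K by auto
    qed
  qed
  ultimately show ?thesis unfolding T2_def by auto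
qed

end

section \<open>Non-critical parameters\<close>

context whittaker_params begin

lemma powi_inj: "q powi j = q powi k \<Longrightarrow> j = k"
proof (rule ccontr)
  have *: False if "q powi j = q powi k" "j < k" for j k
  proof -
    have "q powi (k - j) = 1" using that(1) q0 by (simp add: power_int_diff)
    hence "q ^ nat (k - j) = 1" using that(2) by (simp add: power_int_def)
    thus False using nru[of "nat (k - j)"] that(2) by simp
  qed
  assume "q powi j = q powi k" "j \<noteq> k"
  thus False using *[of j k] *[of k j] by (metis linorder_neqE)
qed

text \<open>A Vandermonde argument: shifting i by one and subtracting q^k times the original removes
  the exponent k and multiplies the other coefficients by q^j - q^k, which is nonzero because q is
  not a root of unity.\<close>

lemma Laurent_coeffs_zero:
  assumes "finite J" "\<And>i. i \<ge> lo \<Longrightarrow> (\<Sum>j\<in>J. d j * q powi (i * j)) = 0" "j \<in> J"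
  shows "d j = 0"
  using assms
proof (induction J arbitrary: d j rule: finite_induct)
  case (insert k J)
  have z: "d j = 0" if j: "j \<in> J" for j
  proof -
    have "(\<Sum>j\<in>J. (d j * (q powi j - q powi k)) * q powi (i * j)) = 0" if i: "i \<ge> lo" for i
    proof -
      have "(\<Sum>j\<in>insert k J. d j * q powi ((i + 1) * j)) - q powi k * (\<Sum>j\<in>insert k J. d j * q powi (i
      * j)) = 0"
        using insert.prems(1)[of i] insert.prems(1)[of "i + 1"] i by simp
      also have "(\<Sum>j\<in>insert k J. d j * q powi ((i + 1) * j)) - q powi k * (\<Sum>j\<in>insert k J. d j
      * q powi (i * j))
        = (\<Sum>j\<in>insert k J. (d j * (q powi j - q powi k)) * q powi (i * j))"
        unfolding sum_distrib_left sum_subtractf[symmetric]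
        by (rule sum.cong) (use q0 in \<open>simp_all add: power_int_add algebra_simps\<close>)
      also have "\<dots> = (\<Sum>j\<in>J. (d j * (q powi j - q powi k)) * q powi (i * j))"
        using insert.hyps by simp
      finally show ?thesis .
    qed
    hence "d j * (q powi j - q powi k) = 0"
      using insert.IH[of "\<lambda>j. d j * (q powi j - q powi k)" j] j by blast
    moreover have "q powi j \<noteq> q powi k" using powi_inj insert.hyps j by blast
    ultimately show ?thesis by simp
  qed
  hence "d k * q powi (lo * k) = 0" using insert.prems(1)[of lo] insert.hyps by simp
  hence "d k = 0" using q0 by simp
  thus ?case using z insert.prems(2) by blast
qed simp

definition dl :: "nat \<Rightarrow> nat \<Rightarrow> (int \<Rightarrow> complex) \<Rightarrow> cfun" where
  "dl a b p = (\<lambda>a' b' i. if a' = a \<and> b' = b then p i else 0)"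

lemma br_nonzero: "br (q ^ Suc n) \<noteq> 0"
proof -
  have "q ^ Suc n * q ^ Suc n \<noteq> 1" unfolding power_add[symmetric] by (rule nru) simp
  thus ?thesis using q0 qq(3) unfolding br_def by (auto simp: field_simps)
qed

lemma act_F2_dl: "act F2 (dl a b p) = scl (br (q ^ Suc a)) (dl (Suc a) b p)"
proof (intro ext)
  fix a' b' i
  show "act F2 (dl a b p) a' b' i = scl (br (q ^ Suc a)) (dl (Suc a) b p) a' b' i"
    by (cases a') (auto simp: act_gn dl_def)
qed

text \<open>The \<open>ff\<close> terms of F2 F1 and q F1 F2 cancel, and the rest is [a + 1] -
  q^(-1) [a] = q^a.\<close>

lemma act_F3: "act (F3 q) h a b i = br (q ^ b) * q ^ a * h a (b - 1) i"
  using q0 \<kappa>0 qx[of i] qq \<alpha>0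
  by (cases a; cases b; simp add: F3_def act_simps powi_shift; (simp add: br_def)?;
        (simp add: divide_simps)?; (simp add: algebra_simps)?)

lemma act_F3_dl: "act (F3 q) (dl 0 b p) = scl (br (q ^ Suc b)) (dl 0 (Suc b) p)"
proof (intro ext)
  fix a' b' i
  show "act (F3 q) (dl 0 b p) a' b' i = scl (br (q ^ Suc b)) (dl 0 (Suc b) p) a' b' i"
    by (cases b') (auto simp: act_F3 dl_def)
qed

lemma act_K2_dl: "act Kg2 (dl 0 0 p) = dl 0 0 (\<lambda>i. q powi i * p i)"
  "act Kg2i (dl 0 0 p) = dl 0 0 (\<lambda>i. p i / q powi i)"
  by (intro ext; simp add: act_gn dl_def)+

lemma v0_dl: "v0 = dl 0 0 (\<lambda>i. 1)"
  unfolding v0_def dl_def ..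

lemma scl_dl: "scl k (dl a b p) = dl a b (\<lambda>i. k * p i)"
  unfolding dl_def by (intro ext) simp

lemma act_Kpow: "act (Kpow j) (dl 0 0 p) = dl 0 0 (\<lambda>i. q powi (i * j) * p i)"
proof -
  have 1: "act (Kg2 ^ n) (dl 0 0 p) = dl 0 0 (\<lambda>i. (q powi i) ^ n * p i)" for n
    by (induction n) (simp_all add: act_1 act_mult act_K2_dl mult.assoc)
  have 2: "act (Kg2i ^ n) (dl 0 0 p) = dl 0 0 (\<lambda>i. p i / (q powi i) ^ n)" for n
    by (induction n) (simp_all add: act_1 act_mult act_K2_dl mult.commute)
  have 3: "q powi (i * j) = (q powi i) powi j" for i by (simp add: power_int_mult)
  show ?thesis unfolding Kpow_def 3
    by (simp add: 1 2 power_int_def field_simps)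
qed

text \<open>The quantum factorial [n]!, undoing the normalisation of the basis built into
  \<open>opg\<close>.\<close>

definition brfact :: "nat \<Rightarrow> complex" where "brfact n = (\<Prod>k<n. br (q ^ Suc k))"

lemma brfact_nonzero: "brfact n \<noteq> 0"
  unfolding brfact_def using br_nonzero by (simp del: power_Suc)

lemma act_F3_power: "act (F3 q ^ n) (dl 0 0 p) = scl (brfact n) (dl 0 n p)"
proof (induction n)
  case 0
  show ?case by (simp add: act_1 brfact_def)
next
  case (Suc n)
  show ?case
    by (simp only:
        power_Suc[of "F3 q"] act_mult Suc act_right_scl act_F3_dl scl_simps(5) brfact_def prod.lessThan_Suc)
qed

lemma act_F2_power: "act (F2 ^ n) (dl 0 b p) = scl (brfact n) (dl n b p)"
proof (induction n)
  case 0
  show ?case by (simp add: act_1 brfact_def)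
next
  case (Suc n)
  show ?case
    by (simp only:
        power_Suc[of "F2"] act_mult Suc act_right_scl act_F2_dl scl_simps(5) brfact_def prod.lessThan_Suc)
qed

lemma act_pbw: "act (pbw q (a, b, j)) v0 = dl a b (\<lambda>i. brfact a * brfact b * q powi (i * j))"
  unfolding pbw_def prod.case v0_dl
  by (simp add: act_mult act_Kpow act_F3_power act_F2_power act_right_scl scl_dl mult_ac)

lemma act_sum: "finite S \<Longrightarrow> act (\<Sum>s\<in>S. f s) h a b i = (\<Sum>s\<in>S. act (f s) h a b i)"
  by (induction S rule: finite_induct) (simp_all add: act_0 act_add)

end

section \<open>Normal forms and the identification of the annihilator\<close>

context whittaker_ideal begin

lemma subspace_I: "fra.subspace I"
  unfolding fra.subspace_def using lidealD[OF I] by simp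

lemma pbw_normal_form:
  "\<exists>S d. finite S \<and> u - (\<Sum>s\<in>S. sc (d s) * pbw q s) \<in> I"
proof -
  \<comment> \<open>Requiring zero coefficients outside the support lets an index be inserted
    whether or not it already occurs.\<close>
  have *: "\<exists>S d. finite S \<and> (\<forall>s. s \<notin> S \<longrightarrow> d s = 0) \<and> x = (\<Sum>s\<in>S. sc (d s) * pbw q s)"
    if "x \<in> fra.span (range (pbw q))" for x
    using that
  proof (induction rule: fra.span_induct_alt)
    case base
    show ?case by (intro exI[of _ "{}"] exI[of _ "\<lambda>_. 0"]) simp
  next
    case (step k p y)
    then obtain S d s0 where S: "finite S" "\<And>s. s \<notin> S \<Longrightarrow> d s = 0" "y = (\<Sum>s\<in>S. sc (d s) * pbw q s)"
      and p: "p = pbw q s0" by blast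
    let ?d = "d(s0 := d s0 + k)"
    have "y = (\<Sum>s\<in>insert s0 S. sc (d s) * pbw q s)"
      unfolding S(3) by (rule sum.mono_neutral_left) (use S(1,2) in \<open>auto simp: sc_simps\<close>)
    moreover have "sc k * p = (\<Sum>s\<in>insert s0 S. if s = s0 then sc k * pbw q s else 0)"
      using S(1) p by (simp add: sum.delta)
    ultimately have "sc k * p + y = (\<Sum>s\<in>insert s0 S. sc (?d s) * pbw q s)"
      by (simp only: sum.distrib[symmetric]) (rule sum.cong, auto simp: sc_simps algebra_simps)
    thus ?case using S(1,2) by (intro exI[of _ "insert s0 S"] exI[of _ ?d]) auto
  qed
  have "u \<in> fra.span (range (pbw q) \<union> I)" using pbw_span by blast
  moreover have "fra.span I = I" using subspace_I by (simp only: fra.span_eq_iff)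
  ultimately obtain x y where xy: "u = x + y" "x \<in> fra.span (range (pbw q))" "y \<in> I"
    unfolding fra.span_Un by auto
  obtain S d where "finite S" "x = (\<Sum>s\<in>S. sc (d s) * pbw q s)" using *[OF xy(2)] by blast
  thus ?thesis using xy by (intro exI[of _ S] exI[of _ d]) simp
qed

text \<open>Because \<open>I\<close> annihilates v0, the values of \<open>act u v0\<close> can be
  read off from the coefficients of a normal form of u.\<close>

lemma normal_form:
  assumes "I \<subseteq> Ker"
  obtains S d where "finite S" "u - (\<Sum>s\<in>S. sc (d s) * pbw q s) \<in> I"
    "\<And>a b i. act u v0 a b i
       = brfact a * brfact b * (\<Sum>j\<in>{j. (a, b, j) \<in> S}. d (a, b, j) * q powi (i * j))"
    "\<And>a b. finite {j. (a, b, j) \<in> S}"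
proof -
  obtain S d where S: "finite S" "u - (\<Sum>s\<in>S. sc (d s) * pbw q s) \<in> I" using pbw_normal_form by blast
  hence "act (u - (\<Sum>s\<in>S. sc (d s) * pbw q s)) v0 = 0" using assms unfolding Ker_def by blast
  hence "act u v0 = act (\<Sum>s\<in>S. sc (d s) * pbw q s) v0"
    by (simp only: act_diff right_minus_eq)
  hence 1: "act u v0 a b i = (\<Sum>s\<in>S. d s * act (pbw q s) v0 a b i)" for a b i
    using S(1) by (simp add: act_sum act_mult act_sc)
  have fin: "finite {j. (a, b, j) \<in> S}" for a b
    by (rule finite_subset[of _ "(snd \<circ> snd) ` S"]) (use S(1) in force)+
  have "act u v0 a b i = brfact a * brfact b * (\<Sum>j\<in>{j. (a, b, j) \<in> S}. d (a, b, j) * q powi (i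
      * j))" for a b i
  proof -
    have "act u v0 a b i = (\<Sum>s\<in>(\<lambda>j. (a, b, j)) ` {j. (a, b, j) \<in> S}. d s * act (pbw q s) v0 a b i)"
      unfolding 1 by (rule sum.mono_neutral_right) (use S(1) in \<open>auto simp: act_pbw dl_def split:
      if_splits\<close>)
    also have "\<dots> = (\<Sum>j\<in>{j. (a, b, j) \<in> S}. d (a, b, j) * act (pbw q (a, b, j)) v0 a b i)"
      by (subst sum.reindex) (auto simp: inj_on_def)
    finally show ?thesis by (simp add: act_pbw dl_def sum_distrib_left mult_ac)
  qed
  thus ?thesis using that S fin by blast
qed

text \<open>For fixed a and b the values are those of a Laurent polynomial at the powers q^i, and
  its coefficients are determined by the range i \<ge> i0 alone.\<close>

lemma act_vanish:
  assumes "I \<subseteq> Ker" "\<And>i. i \<ge> i0 \<Longrightarrow> act u v0 a b i = 0"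
  shows "act u v0 a b i = 0"
proof -
  obtain S d where S: "finite S" "u - (\<Sum>s\<in>S. sc (d s) * pbw q s) \<in> I"
    "\<And>a b i. act u v0 a b i
       = brfact a * brfact b * (\<Sum>j\<in>{j. (a, b, j) \<in> S}. d (a, b, j) * q powi (i * j))"
    "\<And>a b. finite {j. (a, b, j) \<in> S}" by (rule normal_form[OF assms(1), of u], rule that)
  have "d (a, b, j) = 0" if "j \<in> {j. (a, b, j) \<in> S}" for j
    by (rule Laurent_coeffs_zero[where lo = i0 and J = "{j. (a, b, j) \<in> S}" and d = "\<lambda>j. d (a, b, j)"])
      (use that assms(2) S(3,4) brfact_nonzero in auto)
  thus ?thesis using S(3) by simp
qed

lemma act_bounded:
  assumes "I \<subseteq> Ker"
  shows "\<exists>m. \<forall>a b i. a + b > m \<longrightarrow> act u v0 a b i = 0"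
proof -
  obtain S d where S: "finite S" "u - (\<Sum>s\<in>S. sc (d s) * pbw q s) \<in> I"
    "\<And>a b i. act u v0 a b i
       = brfact a * brfact b * (\<Sum>j\<in>{j. (a, b, j) \<in> S}. d (a, b, j) * q powi (i * j))"
    "\<And>a b. finite {j. (a, b, j) \<in> S}" by (rule normal_form[OF assms, of u], rule that)
  define m where "m = Max (insert 0 ((\<lambda>(a, b, j). a + b) ` S))"
  have "a + b \<le> m" if "(a, b, j) \<in> S" for a b j
    unfolding m_def using S(1) that by (intro Max_ge) force+
  hence "{j. (a, b, j) \<in> S} = {}" if "a + b > m" for a b using that by (auto simp: not_le[symmetric])
  thus ?thesis unfolding S(3) by (intro exI[of _ m]) simp
qed

text \<open>The independence half: if u annihilates v0, all coefficients of its normal form vanish,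
  so u lies in \<open>I\<close>.\<close>

lemma Ker_eq:
  assumes "I \<subseteq> Ker"
  shows "Ker = I"
proof
  show "Ker \<subseteq> I"
  proof
    fix u assume u: "u \<in> Ker"
    obtain S d where S: "finite S" "u - (\<Sum>s\<in>S. sc (d s) * pbw q s) \<in> I"
    "\<And>a b i. act u v0 a b i
       = brfact a * brfact b * (\<Sum>j\<in>{j. (a, b, j) \<in> S}. d (a, b, j) * q powi (i * j))"
    "\<And>a b. finite {j. (a, b, j) \<in> S}" by (rule normal_form[OF assms(1), of u], rule that)
    have "d (a, b, j) = 0" if "(a, b, j) \<in> S" for a b j
      by (rule Laurent_coeffs_zero[where lo = 0 and J = "{j. (a, b, j) \<in> S}" and d = "\<lambda>j. d (a, b, j)"])
        (use that u S(3,4) brfact_nonzero in \<open>auto simp: Ker_def\<close>)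
    hence "(\<Sum>s\<in>S. sc (d s) * pbw q s) = 0" by (intro sum.neutral) (auto simp: sc_simps)
    thus "u \<in> I" using S(2) by simp
  qed
qed fact

text \<open>Up to the nonzero factor -\<alpha> (q - q^(-1))^2, h_m is the value of \<open>ff\<close>
  at q^(m-1).\<close>

lemma ff_zero_critical:
  assumes "m \<ge> 1" "ff (q powi (int m - 1)) = 0"
  shows "hpoly q m \<kappa> c = 0"
proof -
  let ?x = "q powi (int m - 1)"
  have A: "(q - 1 / q)^2 * c = \<kappa> * q / ?x^2 + ?x^2 / (\<kappa> * q)"
    using assms(2) \<alpha>0 qq(3) unfolding ff_def by (simp add: field_simps)
  have B: "q powi (3 - 2 * int m) = q / ?x^2"
  proof -
    have e: "3 - 2 * int m = 1 - ((int m - 1) + (int m - 1))" by simp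
    show ?thesis unfolding e using q0
      by (subst power_int_diff) (simp, subst power_int_add, simp_all add: power2_eq_square)
  qed
  have C: "q powi (2 * int m - 3) = ?x^2 / q"
  proof -
    have e: "2 * int m - 3 = ((int m - 1) + (int m - 1)) - 1" by simp
    show ?thesis unfolding e using q0
      by (subst power_int_diff) (simp, subst power_int_add, simp_all add: power2_eq_square)
  qed
  show ?thesis unfolding hpoly_def B C inverse_eq_divide A by (simp add: mult.commute)
qed

text \<open>The second term of E1 has the factor [a], so on the column a = 0 only the shift in i
  survives.\<close>

lemma E1_power_top: "act (E1 ^ k * u) v0 0 b i = \<alpha> ^ k * act u v0 0 b (i + int k)"
  by (induction k arbitrary: i) (simp_all add: act_mult act_1 act_gn algebra_simps)

lemma noncritical_imp_maximal:
  assumes IK: "I \<subseteq> Ker" and nc: "\<not> critical q \<kappa> c" and N: "submod regA N" "I \<subseteq> N" "N \<noteq> I"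
  shows "N = UNIV"
proof -
  note Nd = lidealD[OF N(1)]
  define bd where "bd m h \<longleftrightarrow> (\<forall>a b i. a + b > m \<longrightarrow> (h :: cfun) a b i = 0)" for m h
  define P where "P m \<longleftrightarrow> (\<exists>u\<in>N. act u v0 \<noteq> 0 \<and> bd m (act u v0))" for m
  obtain u0 where "u0 \<in> N" "act u0 v0 \<noteq> 0" using N Ker_eq[OF IK] unfolding Ker_def by blast
  hence "\<exists>m. P m" using act_bounded[OF IK, of u0] unfolding P_def bd_def by blast
  define m where "m = (LEAST m. P m)"
  have Pm: "P m" unfolding m_def using \<open>\<exists>m. P m\<close> by (rule LeastI_ex)
  have least: "act u v0 = 0" if "u \<in> N" "bd k (act u v0)" "k < m" for u k
    using not_less_Least[of k P] that unfolding m_def P_def by blast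
  from Pm obtain u where u: "u \<in> N" "act u v0 \<noteq> 0" "bd m (act u v0)" unfolding P_def by blast
  have m0: "m = 0"
  proof (rule ccontr)
    assume "m \<noteq> 0"
    then obtain n where n: "m = Suc n" using not0_implies_Suc by blast
    \<comment> \<open>E2 lowers the degree, so by minimality of m its result must be zero.\<close>
    have E2: "act (E2 * w) v0 = 0" if w: "w \<in> N" "bd m (act w v0)" for w
    proof (rule least)
      show "E2 * w \<in> N" using Nd(3) w by blast
      show "bd n (act (E2 * w) v0)" using w(2) unfolding bd_def n by (simp add: act_mult act_gn)
    qed (simp add: n)
    have E1: "E1 ^ k * u \<in> N \<and> bd m (act (E1 ^ k * u) v0)" for k
    proof (induction k)
      case (Suc k)
      have "bd m (act (E1 * (E1 ^ k * u)) v0)"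
        unfolding bd_def
      proof (intro allI impI)
        fix a b i assume ab: "m < a + b"
        have "act (E1 ^ k * u) v0 a b (i + 1) = 0" "a \<noteq> 0 \<Longrightarrow> act (E1 ^ k * u) v0 (a - 1) (b + 1) i = 0"
          using Suc ab unfolding bd_def by auto
        thus "act (E1 * (E1 ^ k * u)) v0 a b i = 0"
          by (subst act_mult, cases "a = 0") (simp_all add: act_gn)
      qed
      thus ?case using Suc Nd(3)[of "E1 ^ k * u" E1] by (simp add: mult.assoc)
    qed (use u in simp)
    have ffn: "ff (q powi int n) \<noteq> 0"
      using ff_zero_critical[of m] nc unfolding critical_def n by auto
    have "act u v0 0 m (int n - 1 + int k) = 0" for k
    proof -
      \<comment> \<open>At i = n the diagonal coefficient [i - n] is zero, which isolates the
        \<open>ff\<close> term. The power of E1 carries the conclusion from the one exponent n - 1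
        to n - 1 + k.\<close>
      have "act (E2 * (E1 ^ k * u)) v0 0 n (int n) = 0" using E2 E1 by simp
      hence "act (E1 ^ k * u) v0 0 (Suc n) (int n - 1) = 0"
        using ffn q0 by (subst (asm) act_mult) (simp add: act_gn)
      thus ?thesis unfolding E1_power_top n using \<alpha>0 by simp
    qed
    hence "act u v0 0 m i = 0" if "i \<ge> int n - 1" for i
      using that by (metis add.commute diff_add_cancel zle_iff_zadd)
    hence top: "act u v0 0 m i = 0" for i using act_vanish[OF IK] by blast
    have z: "act u v0 a b i = 0" if "a + b = m" for a b i
      using that
    proof (induction a arbitrary: b i)
      case 0
      thus ?case using top by simp
    next
      case (Suc a)
      \<comment> \<open>The \<open>ff\<close> term is zero by induction, and i \<ge> m avoids the
        zero of the bracket at i = a + b = m - 1; the remaining exponents follow by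
        \<open>act_vanish\<close>.\<close>
      have "act u v0 (Suc a) b i = 0" if "i \<ge> int m" for i
      proof -
        have "act (E2 * u) v0 a b i = 0" using E2 u by simp
        hence "br (q powi i / (q ^ a * q ^ b)) * act u v0 (Suc a) b i = 0"
          using Suc by (subst (asm) act_mult) (simp add: act_gn)
        moreover have "q powi i / (q ^ a * q ^ b) = q ^ Suc (nat (i - int m))"
        proof -
          have "i = int (Suc (nat (i - int m))) + int (a + b)" using that Suc(2) by simp
          hence "q powi i = q powi (int (Suc (nat (i - int m))) + int (a + b))" by (rule arg_cong)
          thus ?thesis using q0 by (simp only: power_int_add power_int_of_nat simp_thms) (simp add:
          power_add)
        qed
        ultimately show ?thesis using br_nonzero by (metis mult_eq_0_iff)
      qed
      thus ?case using act_vanish[OF IK] by blast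
    qed
    have "bd n (act u v0)" unfolding bd_def
    proof (intro allI impI)
      fix a b i assume "n < a + b"
      thus "act u v0 a b i = 0" using z[of a b i] u(3) unfolding bd_def n by (cases "a + b = Suc n") auto
    qed
    thus False using least[OF u(1), of n] u(2) n by simp
  qed
  \<comment> \<open>N contains \<open>I = Ker\<close>, so membership in N depends only on the image
    of v0.\<close>
  have N_ext: "w \<in> N" if "act w v0 = act w' v0" "w' \<in> N" for w w'
  proof -
    have "w - w' \<in> Ker" unfolding Ker_def using that by (simp only: act_diff mem_Collect_eq diff_self)
    hence "w - w' + w' \<in> N" using that Nd(2) N(2) Ker_eq[OF IK] by blast
    thus ?thesis by simp
  qed
  \<comment> \<open>K2^j v is an E1-eigenvector with eigenvalue \<alpha> q^j. These eigenvalues are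
    distinct, so E1 - \<alpha> q^k removes the term k and keeps the others nonzero.\<close>
  have mono: "\<exists>w\<in>N. \<exists>j. act w v0 = dl 0 0 (\<lambda>i. q powi (i * j))"
    if "finite J" "J \<noteq> {}" "\<And>j. j \<in> J \<Longrightarrow> d j \<noteq> 0" "w \<in> N" "act w v0 = dl 0 0 (\<lambda>i. \<Sum>j\<in>J. d j
        * q powi (i * j))" for J d w
    using that
  proof (induction J arbitrary: d w rule: finite_induct)
    case (insert k J)
    show ?case
    proof (cases "J = {}")
      case True
      have "act (sc (inverse (d k)) * w) v0 = dl 0 0 (\<lambda>i. q powi (i * k))"
        using insert.prems True by (simp add: act_mult act_sc scl_dl mult.assoc[symmetric])
      thus ?thesis using Nd(3)[OF insert.prems(3)] by blast
    next
      case False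
      let ?w = "(E1 - sc (\<alpha> * q powi k)) * w"
      have "act ?w v0 = dl 0 0 (\<lambda>i. \<alpha> * (\<Sum>j\<in>insert k J. d j * q powi ((i + 1) * j))
          - \<alpha> * q powi k * (\<Sum>j\<in>insert k J. d j * q powi (i * j)))"
        unfolding act_mult act_diff act_sc insert.prems(4) by (intro ext) (simp add: act_gn dl_def)
      also have "\<dots> = dl 0 0 (\<lambda>i. \<Sum>j\<in>J. \<alpha> * d j * (q powi j - q powi k) * q powi (i * j))"
      proof -
        have "\<alpha> * (\<Sum>j\<in>insert k J. d j * q powi ((i + 1) * j))
          - \<alpha> * q powi k * (\<Sum>j\<in>insert k J. d j * q powi (i * j))
          = (\<Sum>j\<in>insert k J. \<alpha> * d j * (q powi j - q powi k) * q powi (i * j))" for i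
          unfolding sum_distrib_left sum_subtractf[symmetric]
          by (rule sum.cong) (use q0 in \<open>simp_all add: power_int_add algebra_simps\<close>)
        thus ?thesis using insert.hyps by simp
      qed
      finally have w: "act ?w v0 = dl 0 0 (\<lambda>i. \<Sum>j\<in>J. \<alpha> * d j * (q powi j - q powi k) * q powi (i * j))" .
      show ?thesis
        by (rule insert.IH[OF False _ Nd(3)[OF insert.prems(3)] w])
          (use insert.prems insert.hyps powi_inj \<alpha>0 in auto)
    qed
  qed simp
  obtain S d where S: "finite S" "u - (\<Sum>s\<in>S. sc (d s) * pbw q s) \<in> I"
    "\<And>a b i. act u v0 a b i
       = brfact a * brfact b * (\<Sum>j\<in>{j. (a, b, j) \<in> S}. d (a, b, j) * q powi (i * j))"
    "\<And>a b. finite {j. (a, b, j) \<in> S}" by (rule normal_form[OF IK, of u], rule that)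
  define J where "J = {j. (0, 0, j) \<in> S \<and> d (0, 0, j) \<noteq> 0}"
  have b0: "brfact 0 = 1" unfolding brfact_def by simp
  have "act u v0 a b i = dl 0 0 (\<lambda>i. \<Sum>j\<in>J. d (0, 0, j) * q powi (i * j)) a b i" for a b i
  proof (cases "a = 0 \<and> b = 0")
    case True
    have "(\<Sum>j\<in>{j. (0, 0, j) \<in> S}. d (0, 0, j) * q powi (i * j)) = (\<Sum>j\<in>J. d (0, 0, j) * q powi (i * j))"
      by (rule sum.mono_neutral_right) (use S(4)[of 0 0] in \<open>auto simp: J_def\<close>)
    thus ?thesis using True unfolding S(3) by (simp add: dl_def b0)
  next
    case False
    thus ?thesis using u(3) unfolding bd_def m0 by (auto simp: dl_def)
  qed
  hence uJ: "act u v0 = dl 0 0 (\<lambda>i. \<Sum>j\<in>J. d (0, 0, j) * q powi (i * j))" by blast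
  have "J \<noteq> {}"
  proof
    assume "J = {}"
    hence "act u v0 = dl 0 0 (\<lambda>i. 0)" unfolding uJ by simp
    moreover have "dl 0 0 (\<lambda>i. 0) = 0" by (intro ext) (simp add: dl_def)
    ultimately show False using u(2) by simp
  qed
  moreover have "finite J" using S(4)[of 0 0] unfolding J_def by simp
  ultimately obtain w j where w: "w \<in> N" "act w v0 = dl 0 0 (\<lambda>i. q powi (i * j))"
    using mono[of J "\<lambda>j. d (0, 0, j)" u] u(1) uJ unfolding J_def by blast
  have "act (Kpow (- j) * w) v0 = act 1 v0"
    unfolding act_mult w(2) act_Kpow act_1 unfolding v0_dl using q0 by (simp flip: power_int_add)
  hence "1 \<in> N" using N_ext Nd(3) w(1) by metis
  thus ?thesis using Nd(3)[of 1] by auto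
qed

end

section \<open>Critical parameters\<close>

context whittaker_params begin

text \<open>The cyclic submodule generated by v0. The ambient space contains arbitrary functions, so
  a singular vector is of use only after it is shown to lie here.\<close>

definition reach :: "cfun set" where "reach = {act u v0 | u. True}"

lemma reach_act: "h \<in> reach \<Longrightarrow> act r h \<in> reach"
  unfolding reach_def by (auto simp flip: act_mult)

lemma reach_add: "h \<in> reach \<Longrightarrow> h' \<in> reach \<Longrightarrow> h + h' \<in> reach"
proof -
  assume "h \<in> reach" "h' \<in> reach"
  then obtain u u' where "h = act u v0" "h' = act u' v0" unfolding reach_def by blast
  hence "h + h' = act (u + u') v0" by (simp only: act_add)
  thus ?thesis unfolding reach_def by blast
qed

lemma reach_scl: "h \<in> reach \<Longrightarrow> scl k h \<in> reach"
  using reach_act[of h "sc k"] by (simp only: act_sc)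

inductive Laurent :: "(int \<Rightarrow> complex) \<Rightarrow> bool" where
  mono: "Laurent (\<lambda>i. k * q powi (i * j))"
| add: "Laurent p \<Longrightarrow> Laurent p' \<Longrightarrow> Laurent (\<lambda>i. p i + p' i)"

lemma Laurent_dl_reach: "Laurent p \<Longrightarrow> dl a b p \<in> reach"
proof (induction rule: Laurent.induct)
  case (mono k j)
  have "scl (k / (brfact a * brfact b)) (act (pbw q (a, b, j)) v0) \<in> reach"
    unfolding reach_def by (rule reach_scl[unfolded reach_def]) blast
  thus ?case using brfact_nonzero by (simp add: act_pbw scl_dl)
next
  case (add p p')
  have "dl a b (\<lambda>i. p i + p' i) = dl a b p + dl a b p'" by (intro ext) (simp add: dl_def)
  thus ?case using add reach_add by metis
qed

lemma Laurent_shift: "Laurent p \<Longrightarrow> Laurent (\<lambda>i. p (i - 1))"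
proof (induction rule: Laurent.induct)
  case (mono k j)
  have "(\<lambda>i. k * q powi ((i - 1) * j)) = (\<lambda>i. (k / q powi j) * q powi (i * j))"
    using q0 by (simp add: power_int_diff algebra_simps)
  thus ?case using Laurent.mono by metis
qed (rule Laurent.add)

lemma Laurent_mult: "Laurent p \<Longrightarrow> Laurent (\<lambda>i. k * q powi (i * l) * p i)"
proof (induction rule: Laurent.induct)
  case (mono k' j)
  have "(\<lambda>i. k * q powi (i * l) * (k' * q powi (i * j))) = (\<lambda>i. (k * k') * q powi (i * (l + j)))"
    using q0 by (simp add: power_int_add algebra_simps)
  thus ?case using Laurent.mono by metis
next
  case (add p p')
  thus ?case using Laurent.add by (simp add: ring_distribs)
qed

text \<open>Up to a constant, the cofactor of x^2 - q^(2n) in \<open>ff x\<close> when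
  h_(n+1)(\<kappa>, c) = 0.\<close>

definition rr :: "nat \<Rightarrow> complex \<Rightarrow> complex" where
  "rr n x = 1 / (q * \<kappa>) - q * \<kappa> / ((q ^ n)\<^sup>2 * x\<^sup>2)"

text \<open>The recursion solves E2 g = 0 for the next component in degree n + 1, the bracket
  [i - n] having been divided out of \<open>ff\<close>. A constant initial component is what the
  eigenvalue \<alpha> of E1 demands on the column a = 0.\<close>

primrec sing :: "nat \<Rightarrow> nat \<Rightarrow> int \<Rightarrow> complex" where
  "sing n 0 = (\<lambda>i. 1)"
| "sing n (Suc a) = (\<lambda>i. q * (q ^ n)\<^sup>2 / (q ^ a * \<alpha> * (q - 1 / q)) * rr n (q powi i) * sing n a (i - 1))"

lemma Laurent_sing: "Laurent (sing n a)"
proof (induction a)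
  case 0
  show ?case using Laurent.mono[of 1 0] by simp
next
  case (Suc a)
  define k where "k = q * (q ^ n)\<^sup>2 / (q ^ a * \<alpha> * (q - 1 / q))"
  define p where "p = (\<lambda>i. sing n a (i - 1))"
  define A where "A = k / (q * \<kappa>)"
  define B where "B = - (k * q * \<kappa> / (q ^ n)\<^sup>2)"
  have "Laurent p" unfolding p_def by (rule Laurent_shift[OF Suc])
  note L = Laurent_mult[OF this]
  have "k * rr n (q powi i) * p i = A * q powi (i * 0) * p i + B * q powi (i * (-2)) * p i" for i
  proof -
    have "q powi (i * 2) = (q powi i)\<^sup>2" by (simp add: power_int_mult)
    hence "q powi (i * (-2)) = 1 / (q powi i)\<^sup>2" by (simp add: power_int_minus inverse_eq_divide)
    hence "k * rr n (q powi i) = A * q powi (i * 0) + B * q powi (i * (-2))"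
      unfolding rr_def A_def B_def by (simp add: right_diff_distrib)
    thus ?thesis by (simp only: distrib_right)
  qed
  hence "sing n (Suc a) = (\<lambda>i. A * q powi (i * 0) * p i + B * q powi (i * (-2)) * p i)"
    unfolding sing.simps k_def p_def by (rule ext)
  thus ?case using Laurent.add[OF L[of A 0] L[of B "-2"]] by (simp only:)
qed

text \<open>The induction step for \<open>sing_diff\<close>: the difference of \<open>rr\<close>
  contributes q^(-a), and [a + 1] = q^(-a) + q [a].\<close>

lemma rr_shift: "x \<noteq> 0 \<Longrightarrow>
    q * (q ^ n)\<^sup>2 / (q ^ a * \<alpha> * (q - 1 / q)) * (rr n (x * q) - rr n x) + \<kappa> * q^2 / (\<alpha> * x^2)
        * br (q ^ a)
     = \<kappa> * q / (\<alpha> * x^2) * br (q ^ Suc a)"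
proof -
  let ?w = "(q ^ n)\<^sup>2" and ?d = "q - 1 / q"
  assume x: "x \<noteq> 0"
  have w: "?w \<noteq> 0" using q0 by simp
  have "rr n (x * q) - rr n x = \<kappa> * ?d / (?w * x\<^sup>2)"
  proof -
    have "1 / (q * \<kappa>) - q * \<kappa> / (W * (x * q)\<^sup>2) - (1 / (q * \<kappa>) - q * \<kappa> / (W * x\<^sup>2)) = \<kappa> * ?d / (W * x\<^sup>2)"
      if "W \<noteq> 0" for W
    proof -
      have "q * \<kappa> / (W * x\<^sup>2) - q * \<kappa> / (W * (x * q)\<^sup>2) = \<kappa> * ?d / (W * x\<^sup>2)"
        using that x q0 by (simp add: power_mult_distrib divide_simps) (simp add:
        algebra_simps power2_eq_square)
      thus ?thesis by simp
    qed
    from this[OF w] show ?thesis unfolding rr_def .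
  qed
  hence 1: "q * ?w / (q ^ a * \<alpha> * ?d) * (rr n (x * q) - rr n x) = \<kappa> * q / (\<alpha> * x^2) * (1 / q ^ a)"
    using w qq(3) by (simp add: mult_ac)
  have 2: "br (q ^ Suc a) = 1 / q ^ a + q * br (q ^ a)"
  proof -
    have "q * y - 1 / (q * y) = 1 / y * ?d + q * (y - 1 / y)" if "y \<noteq> 0" for y
      using that q0 by (simp add: field_simps)
    from this[of "q ^ a"] show ?thesis
      using q0 qq(3) unfolding br_def by (simp add: add_divide_distrib)
  qed
  have "K * q / Y * (1 / y) + K * q\<^sup>2 / Y * B = K * q / Y * (1 / y + q * B)" for K Y y B
    by (simp add: power2_eq_square distrib_left)
  thus ?thesis unfolding 1 2 .
qed

text \<open>This is E1 g = \<alpha> g componentwise. The difference of the product in the recursion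
  splits into the difference of \<open>rr\<close> and that of the previous component, and both parts
  become multiples of \<open>sing n a i\<close>.\<close>

lemma sing_diff:
  "sing n a (i + 1) - sing n a i = \<kappa> * q / (\<alpha> * (q powi i)^2) * br (q ^ a) * sing n (a - 1) i"
proof (induction a arbitrary: i)
  case 0
  show ?case by simp
next
  case (Suc a)
  let ?C = "q * (q ^ n)\<^sup>2 / (q ^ a * \<alpha> * (q - 1 / q))" and ?x = "q powi i"
  have x: "?x \<noteq> 0" using q0 by simp
  have *: "?C * rr n ?x * (sing n a i - sing n a (i - 1)) = \<kappa> * q^2 / (\<alpha> * ?x^2) * br (q ^ a)
      * sing n a i"
  proof (cases a)
    case 0
    thus ?thesis by simp
  next
    case (Suc a')
    have 1: "sing n a i - sing n a (i - 1) = \<kappa> * q / (\<alpha> * (?x / q)^2) * br (q ^ a) * sing n a' (i - 1)"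
      using Suc.IH[of "i - 1"] Suc by (simp add: powi_shift)
    \<comment> \<open>\<open>?C\<close> is the recursion factor for a; the one for a' = a - 1 is q
      times as large.\<close>
    have 2: "sing n a i = q * ?C * rr n ?x * sing n a' (i - 1)"
      using Suc q0 by simp
    have "C * R * (\<kappa> * q / (\<alpha> * (?x / q)^2) * B * S) = \<kappa> * q^2 / (\<alpha> * ?x^2) * B * (q * C * R
        * S)" for B C R S
      using q0 by (simp add: power2_eq_square)
    thus ?thesis unfolding 1 unfolding 2 .
  qed
  have "sing n (Suc a) (i + 1) - sing n (Suc a) i
     = (?C * (rr n (?x * q) - rr n ?x)) * sing n a i + ?C * rr n ?x * (sing n a i - sing n a (i - 1))"
  proof -
    have A: "sing n (Suc a) (i + 1) = ?C * rr n (?x * q) * sing n a i" by (simp add: powi_shift)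
    have alg: "C * A * s - C * B * t = (C * (A - B)) * s + C * B * (s - t)" for A B C s t :: complex
      by (simp add: algebra_simps)
    show ?thesis unfolding A unfolding sing.simps by (rule alg)
  qed
  also have "\<dots> = (?C * (rr n (?x * q) - rr n ?x) + \<kappa> * q^2 / (\<alpha> * ?x^2) * br (q ^ a)) * sing n a i"
    unfolding * by (simp only: distrib_right)
  also have "\<dots> = \<kappa> * q / (\<alpha> * ?x^2) * br (q ^ Suc a) * sing n a i"
    unfolding rr_shift[OF x] ..
  finally show ?case by simp
qed

definition svec :: "nat \<Rightarrow> cfun" where "svec n = (\<lambda>a b i. if a + b = Suc n then sing n a i else 0)"

lemma svec_E1: "act E1 (svec n) = scl \<alpha> (svec n)"
proof (intro ext)
  fix a b i
  have 1: "\<alpha> * sing n a (i + 1) - \<kappa> * q / (q powi i)^2 * br (q ^ a) * sing n (a - 1) i = \<alpha> * sing n a i"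
  proof -
    have "\<alpha> * (sing n a (i + 1) - sing n a i) = \<kappa> * q / (q powi i)^2 * br (q ^ a) * sing n (a - 1) i"
      unfolding sing_diff using \<alpha>0 by simp
    thus ?thesis by (simp add: algebra_simps)
  qed
  show "act E1 (svec n) a b i = scl \<alpha> (svec n) a b i"
    using 1 by (cases a) (auto simp: act_gn svec_def)
qed

lemma svec_E2:
  assumes "hpoly q (Suc n) \<kappa> c = 0"
  shows "act E2 (svec n) = 0"
proof (intro ext)
  fix a b i
  let ?x = "q powi i" and ?w = "q ^ n"
  have x: "?x \<noteq> 0" "?w \<noteq> 0" using q0 by auto
  have e1: "q powi (3 - 2 * int (Suc n)) = q / ?w^2"
  proof -
    have e: "3 - 2 * int (Suc n) = 1 - (int n + int n)" by simp
    show ?thesis unfolding e using q0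
      by (subst power_int_diff) (simp, subst power_int_add, simp_all add: power2_eq_square)
  qed
  have e2: "q powi (2 * int (Suc n) - 3) = ?w^2 / q"
  proof -
    have e: "2 * int (Suc n) - 3 = (int n + int n) - 1" by simp
    show ?thesis unfolding e using q0
      by (subst power_int_diff) (simp, subst power_int_add, simp_all add: power2_eq_square)
  qed
  have "(q - 1 / q)^2 * c = \<kappa> * q / ?w^2 + ?w^2 / (\<kappa> * q)"
    using assms unfolding hpoly_def e1 e2 inverse_eq_divide by (simp add: mult.commute)
  hence c: "c = (\<kappa> * q / ?w^2 + ?w^2 / (\<kappa> * q)) / (q - 1 / q)^2"
    using qq(3) by (simp add: field_simps)
  \<comment> \<open>Criticality gives c the value for which \<open>ff\<close> vanishes at q^n; as
    \<open>ff\<close> involves only x^2 and x^(-2), the factor x^2 - q^(2n) splits off and will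
    cancel against the bracket.\<close>
  have ff: "ff ?x = - ((?x^2 - ?w^2) * rr n ?x / (\<alpha> * (q - 1 / q)^2))"
  proof -
    have "(?x^2 - ?w^2) * rr n ?x = \<kappa> * q / ?x^2 + ?x^2 / (\<kappa> * q) - (\<kappa> * q / ?w^2 + ?w^2 / (\<kappa> * q))"
      using x q0 \<kappa>0 unfolding rr_def by (simp add: divide_simps) (simp add:
      algebra_simps eval_nat_numeral)
    hence "c - (\<kappa> * q / ?x^2 + ?x^2 / (\<kappa> * q)) / (q - 1 / q)^2 = - ((?x^2 - ?w^2) * rr n ?x / (q
        - 1 / q)^2)"
      by (simp add: c diff_divide_distrib)
    thus ?thesis unfolding ff_def by (simp add: mult.commute)
  qed
  show "act E2 (svec n) a b i = 0 a b i"
  proof (cases "a + b = n")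
    case True
    have w: "?w = q ^ a * q ^ b" unfolding True[symmetric] by (rule power_add)
    have alg: "(x / (y * z) - 1 / (x / (y * z))) / d * (q * (y * z)\<^sup>2 / (y * \<alpha> * d) * R * S)
        + z * q / x * - ((x\<^sup>2 - (y * z)\<^sup>2) * R / (\<alpha> * d\<^sup>2)) * S = 0"
      if "x \<noteq> 0" "y \<noteq> 0" "z \<noteq> 0" "d \<noteq> 0" for x y z d R S
      using that q0 \<alpha>0 by (simp add: field_simps power2_eq_square)
    have "br (?x / ?w) * sing n (Suc a) i + q ^ b * q / ?x * ff ?x * sing n a (i - 1) = 0"
      unfolding br_def ff sing.simps unfolding w by (rule alg) (use x q0 qq in auto)
    thus ?thesis using True by (simp add: act_gn svec_def w[symmetric])
  qed (simp add: act_gn svec_def)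
qed

text \<open>The components with a \<le> n + 1 are added one at a time, each being a Laurent
  polynomial.\<close>

lemma svec_reach: "svec n \<in> reach"
proof -
  have zero: "0 \<in> reach" using act_0[of v0, symmetric] unfolding reach_def by blast
  have "(\<lambda>a b i. if a + b = Suc n \<and> a < k then sing n a i else 0) \<in> reach" for k
  proof (induction k)
    case 0
    show ?case using zero by (simp add: zero_fun_def)
  next
    case (Suc k)
    show ?case
    proof (cases "k \<le> Suc n")
      case True
      have eq: "(\<lambda>a b i. if a + b = Suc n \<and> a < Suc k then sing n a i else 0)
         = (\<lambda>a b i. if a + b = Suc n \<and> a < k then sing n a i else 0) + dl k (Suc n - k) (sing n k)"
        using True by (intro ext) (auto simp: dl_def)
      show ?thesis unfolding eq by (rule reach_add[OF Suc Laurent_dl_reach[OF Laurent_sing]])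
    next
      case False
      have eq: "(\<lambda>a b i. if a + b = Suc n \<and> a < Suc k then sing n a i else 0)
         = (\<lambda>a b i. if a + b = Suc n \<and> a < k then sing n a i else 0)"
        by (intro ext) (use False in auto)
      show ?thesis unfolding eq by (rule Suc)
    qed
  qed
  moreover have "svec n = (\<lambda>a b i. if a + b = Suc n \<and> a < Suc (Suc n) then sing n a i else 0)"
    unfolding svec_def by (intro ext) auto
  ultimately show ?thesis by simp
qed

text \<open>The F's and K's never lower the degree, so the submodule generated by the singular
  vector lives in degrees above n and misses the cyclic vector.\<close>

lemma critical_submodule:
  assumes "critical q \<kappa> c"
  shows "\<exists>N. submod regA N \<and> Ker \<subseteq> N \<and> N \<noteq> Ker \<and> N \<noteq> UNIV"
proof -
  obtain n where "hpoly q (Suc n) \<kappa> c = 0"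
    using assms unfolding critical_def by (metis Suc_le_D One_nat_def)
  note E2 = svec_E2[OF this]
  obtain w where w: "act w v0 = svec n" using svec_reach[of n] unfolding reach_def by (auto dest: sym)
  let ?N = "FKcl Ker w"
  have "submod regA ?N"
  proof (rule FKcl_submod[OF Ker_memI(5) Ker_submod])
    have "E1 * w - sc \<alpha> * w \<in> Ker" "E2 * w \<in> Ker"
      unfolding Ker_def by (simp_all only:
      mem_Collect_eq act_diff act_mult w svec_E1 E2 act_sc diff_self)
    thus "E2 * w \<in> ?N" by (simp add: FKcl.base)
    have "(E1 * w - sc \<alpha> * w) + sc \<alpha> * w \<in> ?N"
      by (intro FKcl.add FKcl.base FKcl.scale FKcl.gen) fact
    thus "E1 * w \<in> ?N" by simp
  qed
  moreover have "Ker \<subseteq> ?N" using FKcl.base by blast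
  moreover have "w \<notin> Ker"
  proof
    assume "w \<in> Ker"
    hence "svec n 0 (Suc n) 0 = 0" unfolding Ker_def by (simp add: w)
    thus False by (simp add: svec_def)
  qed
  moreover have "1 \<notin> ?N"
  proof
    have "\<forall>a b i. a + b \<le> n \<longrightarrow> act u v0 a b i = 0" if "u \<in> ?N" for u
      using that
    proof (induction)
      case gen
      show ?case unfolding w svec_def by simp
    next
      case (mult u g)
      show ?case
      proof (intro allI impI)
        fix a b i assume ab: "a + b \<le> n"
        have "br (q ^ a) * act u v0 (a - 1) b i = 0" for i using mult(3) ab by (cases a) auto
        \<comment> \<open>For b = 0 the truncated index has degree a + 1, possibly beyond the
          induction hypothesis; there the factor \<open>br 1 = 0\<close> takes over.\<close>
        moreover have "br (q ^ b) * act u v0 (a + 1) (b - 1) i = 0" for i using mult(3) ab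
        by (cases b) auto
        moreover have "act u v0 a b i = 0" for i using mult(3) ab by blast
        ultimately show "act (gn g * u) v0 a b i = 0"
          using mult(2) by (subst act_mult) (auto simp: act_gn)
      qed
    qed (simp_all add: act_add act_mult act_sc Ker_def)
    moreover assume "1 \<in> ?N"
    ultimately have "v0 0 0 0 = 0" using act_1[of v0] by (metis add_0 le0)
    thus False by (simp add: v0_def)
  qed
  ultimately show ?thesis using FKcl.gen[of w Ker] by blast
qed

end

section \<open>Return to M(eta) and V(eta; kappa, c)\<close>

theorem theorem4p7:
  fixes q \<alpha> \<kappa> c :: complex
  assumes "q \<noteq> 0" and "\<forall>n::nat. n \<ge> 1 \<longrightarrow> q ^ n \<noteq> 1"
    and "\<alpha> \<noteq> 0" and "\<kappa> \<noteq> 0"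
  shows "(maximal_submod (Mmod q \<alpha>) (Wsub q \<alpha> \<kappa> c) \<longleftrightarrow> \<not> critical q \<kappa> c)
       \<and> (irr_whittaker_mod q \<alpha> (Vmod q \<alpha> \<kappa> c) \<longleftrightarrow> \<not> critical q \<kappa> c)"
proof -
  interpret whittaker_params q \<alpha> \<kappa> c using assms by unfold_locales auto
  define L where "L = Lideal q \<alpha>"
  define W where "W = Wsub q \<alpha> \<kappa> c"
  have L: "submod regA L"
    unfolding L_def Lideal_def by (rule submod_gen_submod[OF _ amodule_regA]) (simp add: regA_def)
  have L_gens: "Uideal q \<subseteq> L" "E1 - sc \<alpha> \<in> L" "E2 \<in> L"
    using gen_submod_superset[of "Uideal q \<union> {E1 - sc \<alpha>, E2}" regA] unfolding L_def Lideal_def by blast+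
  have L_Ker: "L \<subseteq> Ker"
    unfolding L_def Lideal_def by (rule gen_submod_least[OF Ker_submod]) (use Ker_memI in blast)
  interpret Q1: quotient_setup regA L by unfold_locales (rule amodule_regA, rule L)
  have M: "Mmod q \<alpha> = Q1.Q" unfolding Mmod_def L_def ..
  have car: "car regA = UNIV" and regA_simps: "addm regA x y = x + y" "actm regA x y = x
      * y" "zerom regA = 0" for x y
    by (simp_all add: regA_def)
  have veta: "veta q \<alpha> = Q1.\<pi> 1" unfolding veta_def L_def ..
  have act_veta: "actm Q1.Q u (Q1.\<pi> 1) = Q1.\<pi> u" for u
    using Q1.Q_act[of 1 u] by (simp add: car regA_simps)
  have W: "submod Q1.Q W" and W_gens: "j \<in> Jid q \<kappa> c \<Longrightarrow> Q1.\<pi> j \<in> W" for j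
  proof -
    have eq: "W = gen_submod Q1.Q {Q1.\<pi> j | j. j \<in> Jid q \<kappa> c}"
      unfolding W_def Wsub_def M veta act_veta ..
    show "submod Q1.Q W"
      unfolding eq by (rule submod_gen_submod[OF _ Q1.amodule_Q]) (auto simp: Q1.Q_simps car)
    show "j \<in> Jid q \<kappa> c \<Longrightarrow> Q1.\<pi> j \<in> W"
      unfolding eq using gen_submod_superset[of "{Q1.\<pi> j | j. j \<in> Jid q \<kappa> c}" Q1.Q] by blast
  qed
  \<comment> \<open>\<open>W\<close> pulled back to the free algebra, where maximality is an
    equivalent question about left ideals.\<close>
  define I where "I = Q1.pre W"
  have I_iff: "u \<in> I \<longleftrightarrow> Q1.\<pi> u \<in> W" for u unfolding I_def Q1.pre_def car by simp
  have I: "submod regA I" unfolding I_def by (rule Q1.submod_pre[OF W])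
  have L_I: "L \<subseteq> I" unfolding I_def by (rule Q1.pre_superset[OF W])
  have CKC: "0 \<in> CKC q" "1 \<in> CKC q"
    unfolding CKC_def using subalg.scal[of 0] subalg.scal[of 1] by (simp_all only: sc_simps)
  have "1 * (Kel - sc \<kappa>) + 0 * (C1el q - sc c) \<in> Jid q \<kappa> c" "0 * (Kel - sc \<kappa>) + 1 * (C1el q
      - sc c) \<in> Jid q \<kappa> c"
    unfolding Jid_def using CKC by blast+
  hence I_gens: "Kel - sc \<kappa> \<in> I" "C1el q - sc c \<in> I" unfolding I_iff using W_gens by simp_all
  \<comment> \<open>The image of \<open>Ker\<close> is a submodule containing the generators of
    \<open>W\<close>; it pulls back to \<open>Ker\<close> itself because \<open>L\<close> lies in
    \<open>Ker\<close>.\<close>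
  have I_Ker: "I \<subseteq> Ker"
  proof -
    have "Jid q \<kappa> c \<subseteq> Ker"
      unfolding Jid_def using lidealD(2,3)[OF Ker_submod] Ker_memI(3,4) by blast
    hence "W \<subseteq> Q1.\<pi> ` Ker"
      unfolding W_def Wsub_def M veta act_veta
      by (intro gen_submod_least Q1.submod_image Ker_submod) blast
    hence "I \<subseteq> Q1.pre (Q1.\<pi> ` Ker)" unfolding I_def Q1.pre_def by blast
    thus ?thesis unfolding Q1.pre_image[OF Ker_submod L_Ker] .
  qed
  interpret whittaker_ideal q \<alpha> \<kappa> c I
  proof unfold_locales
    show "submod regA I" by (rule I)
    show "Uideal q \<subseteq> I" "E1 - sc \<alpha> \<in> I" "E2 \<in> I" using L_gens L_I by blast+
    show "Kel - sc \<kappa> \<in> I" "C1el q - sc c \<in> I" by (rule I_gens)+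
  qed
  have Ker: "Ker = I" by (rule Ker_eq[OF I_Ker])
  have max_I: "maximal_submod regA I \<longleftrightarrow> \<not> critical q \<kappa> c"
  proof
    assume max: "maximal_submod regA I"
    show "\<not> critical q \<kappa> c"
    proof
      assume "critical q \<kappa> c"
      from critical_submodule[OF this] obtain N where "submod regA N" "I \<subseteq> N" "N \<noteq> I" "N \<noteq> UNIV"
        unfolding Ker by blast
      thus False using max unfolding maximal_submod_def car by blast
    qed
  next
    assume nc: "\<not> critical q \<kappa> c"
    have "I \<noteq> UNIV" using I_Ker Ker_memI(6) by blast
    thus "maximal_submod regA I"
      using I noncritical_imp_maximal[OF I_Ker nc] unfolding maximal_submod_def car by blast
  qed
  have max_W: "maximal_submod Q1.Q W \<longleftrightarrow> \<not> critical q \<kappa> c"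
    using Q1.maximal_quotient_iff[OF W] max_I unfolding I_def by simp
  interpret Q2: quotient_setup Q1.Q W by unfold_locales (rule Q1.amodule_Q, rule W)
  have V: "Vmod q \<alpha> \<kappa> c = Q2.Q" unfolding Vmod_def M W_def ..
  have \<pi>_car: "Q1.\<pi> u \<in> car Q1.Q" for u unfolding Q1.Q_simps car by simp
  let ?w = "Q2.\<pi> (Q1.\<pi> 1)"
  have act_w: "actm Q2.Q u ?w = Q2.\<pi> (Q1.\<pi> u)" for u
    unfolding Q2.Q_act[OF \<pi>_car] act_veta ..
  \<comment> \<open>This holds for critical and non-critical parameters alike, so only simplicity is
    decided by criticality.\<close>
  have "whittaker_mod q \<alpha> Q2.Q"
    unfolding whittaker_mod_def
  proof (intro conjI bexI)
    show "is_Umodule q Q2.Q"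
    proof (rule Q2.Umodule_Q)
      fix r x assume r: "r \<in> Urels q" and "x \<in> car Q1.Q"
      then obtain u where x: "x = Q1.\<pi> u" unfolding Q1.Q_simps by blast
      have "r * u \<in> I" using Uideal_right[OF Uideal_base[OF r]] L_gens L_I by blast
      thus "actm Q1.Q r x \<in> W" unfolding x I_iff using Q1.Q_act[of u r] by (simp add: car regA_simps)
    qed
    show w: "?w \<in> car Q2.Q" unfolding Q2.Q_simps using \<pi>_car by blast
    have "1 \<notin> I" using I_Ker Ker_memI(6) by blast
    thus "?w \<noteq> zerom Q2.Q" unfolding Q2.Q_simps Q2.coset_eq_N_iff[OF \<pi>_car] I_iff .
    have "Q1.\<pi> (sc \<alpha> + (E1 - sc \<alpha>)) = Q1.\<pi> (sc \<alpha>)"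
      using Q1.coset_add_right[of "sc \<alpha>" "E1 - sc \<alpha>"] L_gens by (simp add: car regA_simps)
    thus "actm Q2.Q E1 ?w = actm Q2.Q (sc \<alpha>) ?w" unfolding act_w by simp
    have "E2 \<in> I" using L_gens L_I by blast
    thus "actm Q2.Q E2 ?w = zerom Q2.Q"
      unfolding act_w Q2.Q_simps Q2.coset_eq_N_iff[OF \<pi>_car] I_iff .
    show "gen_submod Q2.Q {?w} = car Q2.Q"
    proof
      have g: "submod Q2.Q (gen_submod Q2.Q {?w})"
        by (rule submod_gen_submod[OF _ Q2.amodule_Q]) (use w in simp)
      show "gen_submod Q2.Q {?w} \<subseteq> car Q2.Q" using submodD(1)[OF g] by blast
      have "?w \<in> gen_submod Q2.Q {?w}" by (rule subsetD[OF gen_submod_superset]) simp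
      hence "Q2.\<pi> (Q1.\<pi> u) \<in> gen_submod Q2.Q {?w}" for u
        using submodD(4)[OF g, of ?w u] by (simp only: act_w)
      thus "car Q2.Q \<subseteq> gen_submod Q2.Q {?w}" unfolding Q2.Q_simps(1) Q1.Q_simps(1) by auto
    qed
  qed
  thus ?thesis
    unfolding irr_whittaker_mod_def V M W_def[symmetric] Q2.simple_quotient_iff max_W by simp
qed

end
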